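(* Let $m=\lfloor \frac n2\rfloor$. For any $n\times n$ complex invertible matrix $G$, there exist an $n\times n$ unitary matrix $U$, an $n\times n$ real invertible matrix $V$, and $m$ unique (up to order and signs) real numbers $\theta_1,\dots,\theta_m$ such that $$G=U\,B_n^{i,\theta}\,V.$$
   Context: $B_n^{i,\theta}$ is the $n\times n$ block diagonal matrix $\operatorname{diag}(B_1,\dots,B_m)$ if $n$ is even and $\operatorname{diag}(1,B_1,\dots,B_m)$ if $n$ is odd, where $$B_l=\begin{bmatrix}\cosh\theta_l & i\sinh\theta_l\\ -i\sinh\theta_l&\cosh\theta_l\end{bmatrix}.$$ *)

theory Defs
  imports
    "Jordan_Normal_Form.Schur_Decomposition"
    "HOL-Combinatorics.Permutations"
begin

definition unitary_mat :: "nat \<Rightarrow> complex mat \<Rightarrow> bool" where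
  "unitary_mat n U \<longleftrightarrow>
     U \<in> carrier_mat n n \<and> mat_adjoint U * U = 1\<^sub>m n \<and> U * mat_adjoint U = 1\<^sub>m n"

definition B_block :: "real \<Rightarrow> complex mat" where
  "B_block t = mat_of_rows_list 2
     [[complex_of_real (cosh t), \<i> * complex_of_real (sinh t)],
      [- \<i> * complex_of_real (sinh t), complex_of_real (cosh t)]]"

(* This is an n x n matrix when length ts = n div 2; the list entry ts ! l is the parameter
   with index l + 1. *)
definition B_mat :: "nat \<Rightarrow> real list \<Rightarrow> complex mat" where
  "B_mat n ts =
     (if even n then diag_block_mat (map B_block ts)
      else diag_block_mat (1\<^sub>m 1 # map B_block ts))"

definition is_UBV_decomposition ::
    "nat \<Rightarrow> complex mat \<Rightarrow> complex mat \<Rightarrow> real list \<Rightarrow> real mat \<Rightarrow> bool" where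
  "is_UBV_decomposition n G U ts V \<longleftrightarrow>
     unitary_mat n U \<and>
     length ts = n div 2 \<and>
     V \<in> carrier_mat n n \<and> invertible_mat V \<and>
     G = U * B_mat n ts * map_mat complex_of_real V"

definition eq_up_to_order_and_signs :: "real list \<Rightarrow> real list \<Rightarrow> bool" where
  "eq_up_to_order_and_signs ts us \<longleftrightarrow>
     length ts = length us \<and>
     (\<exists>p s. p permutes {..<length ts} \<and>
        (\<forall>l<length ts. s l \<in> {1, -1} \<and> us ! l = s l * ts ! p l))"

end

theory Submission
  imports Defs "Jordan_Normal_Form.Spectral_Radius"
begin

text \<open>Since \<open>B\<close> is Hermitian, \<open>G = U B V\<close> with \<open>U\<close> unitary amounts to the congruence
  \<open>H = V\<^sup>T B\<^sup>2 V\<close> of the positive definite matrix \<open>H = G\<^sup>* G = S + i A\<close>, where \<open>S\<close> is real symmetric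
  positive definite and \<open>A\<close> is real skew-symmetric. A Cholesky factorization of \<open>S\<close> reduces to
  \<open>S = 1\<close>; then positivity of \<open>1 + i A\<close> says that \<open>A\<close> is a strict contraction, and the orthogonal
  normal form of \<open>A\<close> has \<open>2 \<times> 2\<close> blocks with entries \<open>\<plusminus>\<mu>\<close>, \<open>\<bar>\<mu>\<bar> < 1\<close>. Writing \<open>\<mu> = tanh (2 \<theta>)\<close> and
  scaling by \<open>cosh (2 \<theta>)\<close> turns such a block into \<open>B\<^sub>\<theta>\<^sup>2\<close>. For uniqueness, the matrix \<open>(cnj H)\<^sup>-\<^sup>1 H\<close> is
  similar to \<open>B\<^sup>4\<close>, whose characteristic polynomial determines the numbers \<open>cosh (4 \<theta>)\<close>.\<close>

section \<open>Direct sums and real congruence\<close>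

lemma inverse_mat_obtain:
  fixes A :: "'a :: field mat"
  assumes A: "A \<in> carrier_mat n n" and "det A \<noteq> 0"
  obtains B where "B \<in> carrier_mat n n" "A * B = 1\<^sub>m n" "B * A = 1\<^sub>m n"
  using det_non_zero_imp_unit[OF assms, unfolded Units_def ring_mat_def, of "()"] by auto

lemma det_nonzero_of_right_inverse:
  fixes A :: "'a :: field mat"
  assumes "A \<in> carrier_mat n n" "B \<in> carrier_mat n n" "A * B = 1\<^sub>m n"
  shows "det A \<noteq> 0"
  using det_mult[OF assms(1,2)] assms(3) by auto

lemma invertible_mat_iff_det:
  fixes A :: "'a :: field mat"
  assumes A: "A \<in> carrier_mat n n"
  shows "invertible_mat A \<longleftrightarrow> det A \<noteq> 0"
proof
  assume "invertible_mat A"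
  then obtain B where "A * B = 1\<^sub>m (dim_row A)" "B * A = 1\<^sub>m (dim_row B)"
    unfolding invertible_mat_def inverts_mat_def by auto
  moreover from this have "B \<in> carrier_mat n n"
    using A by (metis carrier_matD(1,2) carrier_matI index_mult_mat(3) index_one_mat(3))
  ultimately show "det A \<noteq> 0"
    using det_nonzero_of_right_inverse[OF A] A by auto
next
  assume "det A \<noteq> 0"
  with A obtain B where "B \<in> carrier_mat n n" "A * B = 1\<^sub>m n" "B * A = 1\<^sub>m n"
    by (rule inverse_mat_obtain)
  then show "invertible_mat A"
    using A unfolding invertible_mat_def inverts_mat_def by auto
qed

abbreviation cmat :: "real mat \<Rightarrow> complex mat" where
  "cmat \<equiv> map_mat complex_of_real"

text \<open>The zero blocks are written as in the recursion of \<open>diag_block_mat\<close>, so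
  that \<open>B_mat\<close> unfolds into nested direct sums.\<close>

abbreviation dsum :: "'a :: zero mat \<Rightarrow> 'a mat \<Rightarrow> 'a mat" where
  "dsum A B \<equiv> four_block_mat A (0\<^sub>m (dim_row A) (dim_col B)) (0\<^sub>m (dim_row B) (dim_col A)) B"

lemma dsum_mult:
  assumes "A \<in> carrier_mat k k" "B \<in> carrier_mat m m" "C \<in> carrier_mat k k" "D \<in> carrier_mat m m"
  shows "dsum A B * dsum C D = dsum (A * C) (B * D :: 'a :: semiring_0 mat)"
  using assms by (simp add: mult_four_block_mat[of _ k k _ m _ m _ _ k _ m])

lemma dsum_transpose:
  assumes "A \<in> carrier_mat k k" "B \<in> carrier_mat m m"
  shows "transpose_mat (dsum A B) = dsum (transpose_mat A) (transpose_mat B)"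
  using assms by (intro eq_matI) auto

lemma dsum_map:
  assumes "h 0 = 0"
  shows "map_mat h (dsum A B) = dsum (map_mat h A) (map_mat h B)"
  using assms by (intro eq_matI) auto

lemma dsum_det:
  fixes A B :: "'a :: idom mat"
  assumes "A \<in> carrier_mat k k" "B \<in> carrier_mat m m"
  shows "det (dsum A B) = det A * det B"
  using assms by (intro det_four_block_mat_lower_left_zero) auto

lemma dsum_one: "dsum (1\<^sub>m k) (1\<^sub>m m) = 1\<^sub>m (k + m)"
  by (intro eq_matI) auto

lemma dsum_mult_append_vec:
  fixes A B :: "'a :: comm_semiring_1 mat"
  assumes "A \<in> carrier_mat k k" "B \<in> carrier_mat m m" "u \<in> carrier_vec k" "v \<in> carrier_vec m"
  shows "dsum A B *\<^sub>v (u @\<^sub>v v) = (A *\<^sub>v u) @\<^sub>v (B *\<^sub>v v)"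
proof -
  have "dsum A B *\<^sub>v (u @\<^sub>v v) = (A *\<^sub>v u + 0\<^sub>m k m *\<^sub>v v) @\<^sub>v (0\<^sub>m m k *\<^sub>v u + B *\<^sub>v v)"
    using assms by (subst four_block_mat_mult_vec[of _ k k _ m _ m]) auto
  also have "\<dots> = (A *\<^sub>v u) @\<^sub>v (B *\<^sub>v v)"
    using assms by (intro arg_cong2[where f = append_vec]) (auto intro!: eq_vecI)
  finally show ?thesis .
qed

lemma cmat_transpose: "cmat (transpose_mat A) = transpose_mat (cmat A)"
  by (intro eq_matI) auto

text \<open>The witness \<open>V\<close> becomes the real factor of the decomposition. For a real
  matrix the transpose is the adjoint, so this congruence respects Hermitian matrices and
  positivity.\<close>

definition real_congruent :: "nat \<Rightarrow> complex mat \<Rightarrow> complex mat \<Rightarrow> bool" where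
  "real_congruent n H C \<longleftrightarrow>
     (\<exists>V\<in>carrier_mat n n. det V \<noteq> 0 \<and> H = transpose_mat (cmat V) * C * cmat V)"

lemma real_congruent_trans:
  assumes "C \<in> carrier_mat n n" "real_congruent n H D" "real_congruent n D C"
  shows "real_congruent n H C"
proof -
  from assms(2) obtain V where V: "V \<in> carrier_mat n n" "det V \<noteq> 0"
      "H = transpose_mat (cmat V) * D * cmat V"
    unfolding real_congruent_def by auto
  from assms(3) obtain W where W: "W \<in> carrier_mat n n" "det W \<noteq> 0"
      "D = transpose_mat (cmat W) * C * cmat W"
    unfolding real_congruent_def by auto
  have "H = transpose_mat (cmat (W * V)) * C * cmat (W * V)"
    using V W assms(1)
    by (simp add: of_real_hom.mat_hom_mult[of _ n n _ n] transpose_mult[of _ n n _ n] assoc_mult_mat[of _ n n _ n _ n])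
  moreover have "det (W * V) \<noteq> 0"
    using V W by (simp add: det_mult[of _ n])
  ultimately show ?thesis
    unfolding real_congruent_def using V W by (intro bexI[of _ "W * V"]) auto
qed

lemma real_congruent_dsum:
  assumes "C \<in> carrier_mat k k" "D \<in> carrier_mat m m"
    and "real_congruent k H C" "real_congruent m J D"
  shows "real_congruent (k + m) (dsum H J) (dsum C D)"
proof -
  from assms(3) obtain V where V: "V \<in> carrier_mat k k" "det V \<noteq> 0"
      "H = transpose_mat (cmat V) * C * cmat V"
    unfolding real_congruent_def by auto
  from assms(4) obtain W where W: "W \<in> carrier_mat m m" "det W \<noteq> 0"
      "J = transpose_mat (cmat W) * D * cmat W"
    unfolding real_congruent_def by auto
  have "dsum H J = transpose_mat (dsum (cmat V) (cmat W)) * dsum C D * dsum (cmat V) (cmat W)"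
    unfolding V(3) W(3) using V W assms(1,2)
    by (simp only: dsum_transpose[of _ k _ m] dsum_mult[of _ k _ m] map_carrier_mat transpose_carrier_mat mult_carrier_mat[of _ k k _ k] mult_carrier_mat[of _ m m _ m])
  moreover have "dsum (cmat V) (cmat W) = cmat (dsum V W)"
    using V W by (subst dsum_map) auto
  moreover have "det (dsum V W) \<noteq> 0"
    unfolding dsum_det[OF V(1) W(1)] using V(2) W(2) by simp
  ultimately show ?thesis
    unfolding real_congruent_def using V W
    by (intro bexI[of _ "dsum V W"]) auto
qed

text \<open>Congruence is symmetric: the inverse of \<open>P\<close> undoes the transformation. A
  reduction of \<open>H\<close> to a simpler matrix thus becomes a factorization of
  \<open>H\<close>.\<close>

lemma real_congruent_of_transform:
  assumes H: "H \<in> carrier_mat n n" and P: "P \<in> carrier_mat n n" "det P \<noteq> 0"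
  shows "real_congruent n H (transpose_mat (cmat P) * H * cmat P)"
proof -
  obtain W where W: "W \<in> carrier_mat n n" "P * W = 1\<^sub>m n" "W * P = 1\<^sub>m n"
    using P by (rule inverse_mat_obtain)
  have 1: "cmat P * cmat W = 1\<^sub>m n"
    using W P of_real_hom.mat_hom_mult[of P n n W n] of_real_hom.mat_hom_one[of n] by metis
  have 2: "transpose_mat (cmat W) * transpose_mat (cmat P) = 1\<^sub>m n"
    using transpose_mult[of "cmat P" n n "cmat W" n] W P 1 by simp
  have "transpose_mat (cmat W) * (transpose_mat (cmat P) * H * cmat P) * cmat W
      = (transpose_mat (cmat W) * transpose_mat (cmat P)) * H * (cmat P * cmat W)"
    using W P H by (simp add: assoc_mult_mat[of _ n n _ n _ n])
  also have "\<dots> = H"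
    using 1 2 H by simp
  finally show ?thesis
    unfolding real_congruent_def using W P det_nonzero_of_right_inverse[of W n P]
    by (intro bexI[of _ W]) auto
qed

section \<open>Orthogonal matrices and skew-symmetric contractions\<close>

lemma scalar_prod_self_pos:
  fixes w :: "real vec"
  assumes "w \<in> carrier_vec n" "w \<noteq> 0\<^sub>v n"
  shows "0 < w \<bullet> w"
proof -
  from assms obtain i where i: "i < n" "w $ i \<noteq> 0"
    by (metis carrier_vecD eq_vecI index_zero_vec(1,2))
  have "0 < (\<Sum>j = 0..<n. w $ j * w $ j)"
    using i by (intro sum_pos2[of _ i]) (auto simp: zero_less_mult_iff linorder_neq_iff)
  then show ?thesis
    using assms(1) by (simp add: scalar_prod_def)
qed

lemma normalize_vec:
  fixes w :: "real vec"
  assumes "w \<in> carrier_vec n" "w \<noteq> 0\<^sub>v n"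
  obtains c where "c > 0" "c * c * (w \<bullet> w) = 1" "(c \<cdot>\<^sub>v w) \<bullet> (c \<cdot>\<^sub>v w) = 1"
proof -
  define c where "c = 1 / sqrt (w \<bullet> w)"
  have "w \<bullet> w > 0" by (rule scalar_prod_self_pos[OF assms])
  then have c: "c > 0" "c * c * (w \<bullet> w) = 1" unfolding c_def by auto
  moreover have "(c \<cdot>\<^sub>v w) \<bullet> (c \<cdot>\<^sub>v w) = c * c * (w \<bullet> w)"
    using assms(1) by simp
  ultimately show ?thesis using that by metis
qed

lemma mat_eq_of_mult_vec:
  fixes A B :: "'a :: comm_semiring_1 mat"
  assumes A: "A \<in> carrier_mat m n" and B: "B \<in> carrier_mat m n"
    and eq: "\<And>v. v \<in> carrier_vec n \<Longrightarrow> A *\<^sub>v v = B *\<^sub>v v"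
  shows "A = B"
proof (rule eq_matI)
  fix i j assume ij: "i < dim_row B" "j < dim_col B"
  have "(A *\<^sub>v unit_vec n j) $ i = (B *\<^sub>v unit_vec n j) $ i"
    using eq by simp
  then show "A $$ (i, j) = B $$ (i, j)"
    using A B ij by simp
qed (use A B in auto)

text \<open>The reflection in the hyperplane orthogonal to \<open>a - b\<close> swaps two unit
  vectors \<open>a\<close> and \<open>b\<close>. It fixes that hyperplane pointwise, which is what
  the extension to two vectors relies on.\<close>

lemma householder:
  fixes a b :: "real vec"
  assumes a: "a \<in> carrier_vec n" "a \<bullet> a = 1" and b: "b \<in> carrier_vec n" "b \<bullet> b = 1"
  obtains R where "R \<in> carrier_mat n n" "transpose_mat R * R = 1\<^sub>m n" "R *\<^sub>v a = b"
    "\<And>w. w \<in> carrier_vec n \<Longrightarrow> w \<bullet> a = w \<bullet> b \<Longrightarrow> R *\<^sub>v w = w"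
proof (cases "a = b")
  case True
  then show ?thesis using a by (intro that[of "1\<^sub>m n"]) auto
next
  case False
  define u where "u = a - b"
  define k where "k = 2 / (u \<bullet> u)"
  define R where "R = mat n n (\<lambda>(i,j). (if i = j then 1 else 0) - k * u $ i * u $ j)"
  have u: "u \<in> carrier_vec n" using a b u_def by auto
  have "u \<noteq> 0\<^sub>v n"
  proof
    assume "u = 0\<^sub>v n"
    then have "(a - b) $ i = 0" if "i < n" for i
      using that unfolding u_def by simp
    then have "a $ i = b $ i" if "i < n" for i
      using that a b by simp
    then show False using False a b by auto
  qed
  then have "u \<bullet> u > 0" by (rule scalar_prod_self_pos[OF u])
  then have k: "k * (u \<bullet> u) = 2" unfolding k_def by simp
  have R: "R \<in> carrier_mat n n" unfolding R_def by simp
  have Rw: "R *\<^sub>v w = w - (k * (u \<bullet> w)) \<cdot>\<^sub>v u" if w: "w \<in> carrier_vec n" for w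
  proof (rule eq_vecI)
    fix i assume "i < dim_vec (w - (k * (u \<bullet> w)) \<cdot>\<^sub>v u)"
    then have i: "i < n" using u by simp
    have "(R *\<^sub>v w) $ i = (\<Sum>j = 0..<n. ((if i = j then 1 else 0) - k * u $ i * u $ j) * w $ j)"
      using i w R by (simp add: scalar_prod_def R_def)
    also have "\<dots> = (\<Sum>j = 0..<n. (if i = j then w $ j else 0)) - k * u $ i * (\<Sum>j = 0..<n. u $ j * w $ j)"
      unfolding sum_distrib_left sum_subtractf[symmetric]
      by (rule sum.cong) (auto simp: algebra_simps)
    also have "\<dots> = (w - (k * (u \<bullet> w)) \<cdot>\<^sub>v u) $ i"
      using i w u by (simp add: scalar_prod_def)
    finally show "(R *\<^sub>v w) $ i = (w - (k * (u \<bullet> w)) \<cdot>\<^sub>v u) $ i" .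
  qed (use w u R in auto)
  have "transpose_mat R = R" unfolding R_def by (intro eq_matI) auto
  moreover have "R * R = 1\<^sub>m n"
  proof (rule mat_eq_of_mult_vec[of _ n n])
    fix v :: "real vec" assume v: "v \<in> carrier_vec n"
    \<comment> \<open>The component along \<open>u\<close> changes sign, so a second application
      restores \<open>v\<close>.\<close>
    have "u \<bullet> (R *\<^sub>v v) = u \<bullet> v - k * (u \<bullet> u) * (u \<bullet> v)"
      unfolding Rw[OF v] using u v by (simp add: scalar_prod_minus_distrib[of _ n])
    then have "u \<bullet> (R *\<^sub>v v) = - (u \<bullet> v)" using k by simp
    then have "R *\<^sub>v (R *\<^sub>v v) = v"
      using v u R Rw[of "R *\<^sub>v v"] by (intro eq_vecI) (simp_all add: Rw[OF v])
    then show "R * R *\<^sub>v v = 1\<^sub>m n *\<^sub>v v" using R v by simp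
  qed (use R in auto)
  moreover have "R *\<^sub>v a = b"
  proof -
    have ab: "b \<bullet> a = a \<bullet> b" using a b by (simp add: comm_scalar_prod)
    \<comment> \<open>Equal lengths of \<open>a\<close> and \<open>b\<close> give
      \<open>u \<bullet> u = 2 * (u \<bullet> a)\<close>; hence the coefficient of \<open>u\<close>
      in \<open>R a\<close> is 1 and \<open>R a = a - u = b\<close>.\<close>
    have "u \<bullet> u = 2 - 2 * (a \<bullet> b)"
      unfolding u_def using a b ab by (simp add: scalar_prod_minus_distrib[of _ n] minus_scalar_prod_distrib[of _ n])
    moreover have "u \<bullet> a = 1 - a \<bullet> b"
      unfolding u_def using a b ab by (simp add: minus_scalar_prod_distrib[of _ n])
    ultimately have "u \<bullet> u = 2 * (u \<bullet> a)" by simp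
    then have "k * (u \<bullet> a) = 1" using k by simp
    then show ?thesis
      using Rw[OF a(1)] a b unfolding u_def by (intro eq_vecI) simp_all
  qed
  moreover have "R *\<^sub>v w = w" if w: "w \<in> carrier_vec n" "w \<bullet> a = w \<bullet> b" for w
  proof -
    have "u \<bullet> w = a \<bullet> w - b \<bullet> w"
      unfolding u_def using a b w by (simp add: minus_scalar_prod_distrib[of _ n])
    also have "\<dots> = 0" using w a b by (simp add: comm_scalar_prod[of _ n w])
    finally show ?thesis using Rw[OF w(1)] w u by (intro eq_vecI) simp_all
  qed
  ultimately show ?thesis using that R by simp
qed

lemma orthogonal_scalar_prod:
  fixes Q :: "real mat"
  assumes "Q \<in> carrier_mat n n" "transpose_mat Q * Q = 1\<^sub>m n" "v \<in> carrier_vec n" "w \<in> carrier_vec n"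
  shows "(Q *\<^sub>v v) \<bullet> (Q *\<^sub>v w) = v \<bullet> w"
proof -
  have "(Q *\<^sub>v v) \<bullet> (Q *\<^sub>v w) = (transpose_mat Q *\<^sub>v (Q *\<^sub>v v)) \<bullet> w"
    using assms by (intro transpose_vec_mult_scalar[of _ n n, symmetric]) auto
  also have "transpose_mat Q *\<^sub>v (Q *\<^sub>v v) = transpose_mat Q * Q *\<^sub>v v"
    using assms by (intro assoc_mult_mat_vec[symmetric]) auto
  finally show ?thesis using assms by simp
qed

lemma orthogonal_extend1:
  fixes x :: "real vec"
  assumes "x \<in> carrier_vec n" "x \<bullet> x = 1" "0 < n"
  obtains Q where "Q \<in> carrier_mat n n" "transpose_mat Q * Q = 1\<^sub>m n" "Q *\<^sub>v unit_vec n 0 = x"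
  using householder[of "unit_vec n 0" n x] assms by auto

text \<open>After moving the first unit vector to \<open>x\<close> by \<open>P\<close>, the vector
  \<open>y\<close> pulls back to \<open>z\<close>, which is orthogonal to the first unit vector. The
  reflection taking the second unit vector to \<open>z\<close> therefore leaves the first one alone
  and can be composed with \<open>P\<close>.\<close>

lemma orthogonal_extend2:
  fixes x y :: "real vec"
  assumes x: "x \<in> carrier_vec n" "x \<bullet> x = 1" and y: "y \<in> carrier_vec n" "y \<bullet> y = 1"
    and xy: "x \<bullet> y = 0" and n: "1 < n"
  obtains Q where "Q \<in> carrier_mat n n" "transpose_mat Q * Q = 1\<^sub>m n"
    "Q *\<^sub>v unit_vec n 0 = x" "Q *\<^sub>v unit_vec n 1 = y"
proof -
  from x n obtain P where P: "P \<in> carrier_mat n n" "transpose_mat P * P = 1\<^sub>m n" "P *\<^sub>v unit_vec n 0 = x"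
    using orthogonal_extend1[of x n] by auto
  define z where "z = transpose_mat P *\<^sub>v y"
  have z: "z \<in> carrier_vec n" using P y z_def by auto
  have PP: "P * transpose_mat P = 1\<^sub>m n"
    by (rule mat_mult_left_right_inverse[OF _ P(1,2)]) (use P in simp)
  then have Pz: "P *\<^sub>v z = y"
    unfolding z_def using P y by (simp add: assoc_mult_mat_vec[of _ n n _ n, symmetric])
  have zz: "z \<bullet> z = 1"
    using orthogonal_scalar_prod[OF P(1,2) z z] Pz y by simp
  have z0: "unit_vec n 0 \<bullet> z = 0"
    using orthogonal_scalar_prod[OF P(1,2) _ z, of "unit_vec n 0"] Pz P xy by simp
  obtain R where R: "R \<in> carrier_mat n n" "transpose_mat R * R = 1\<^sub>m n" "R *\<^sub>v unit_vec n 1 = z"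
    "\<And>w. w \<in> carrier_vec n \<Longrightarrow> w \<bullet> unit_vec n 1 = w \<bullet> z \<Longrightarrow> R *\<^sub>v w = w"
    using householder[of "unit_vec n 1" n z] z zz n by auto
  have "R *\<^sub>v unit_vec n 0 = unit_vec n 0"
    using z0 n by (intro R(4)) auto
  moreover have "transpose_mat (P * R) * (P * R) = transpose_mat R * (transpose_mat P * P) * R"
    using P(1) R(1) by (simp add: transpose_mult[of _ n n _ n] assoc_mult_mat[of _ n n _ n _ n])
  then have "transpose_mat (P * R) * (P * R) = 1\<^sub>m n" using P R by simp
  ultimately show ?thesis
    using P R Pz by (intro that[of "P * R"]) auto
qed

section \<open>Real skew-symmetric matrices: invariant lines and planes, and deflation\<close>

definition skew_mat :: "nat \<Rightarrow> real mat \<Rightarrow> bool" where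
  "skew_mat n K \<longleftrightarrow> K \<in> carrier_mat n n \<and> transpose_mat K = - K"

definition strict_contraction :: "nat \<Rightarrow> real mat \<Rightarrow> bool" where
  "strict_contraction n K \<longleftrightarrow>
     (\<forall>v\<in>carrier_vec n. v \<noteq> 0\<^sub>v n \<longrightarrow> (K *\<^sub>v v) \<bullet> (K *\<^sub>v v) < v \<bullet> v)"

lemma skew_scalar_prod:
  assumes "skew_mat n K" "v \<in> carrier_vec n" "w \<in> carrier_vec n"
  shows "v \<bullet> (K *\<^sub>v w) = - ((K *\<^sub>v v) \<bullet> w)"
proof -
  have "v \<bullet> (K *\<^sub>v w) = (transpose_mat K *\<^sub>v v) \<bullet> w"
    using assms unfolding skew_mat_def by (intro transpose_vec_mult_scalar[of _ n n, symmetric]) auto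
  also have "transpose_mat K *\<^sub>v v = - (K *\<^sub>v v)"
    using assms unfolding skew_mat_def by auto
  finally show ?thesis
    using assms unfolding skew_mat_def by auto
qed

lemma skew_scalar_prod_self:
  assumes "skew_mat n K" "v \<in> carrier_vec n"
  shows "v \<bullet> (K *\<^sub>v v) = 0"
proof -
  have "(K *\<^sub>v v) \<bullet> v = v \<bullet> (K *\<^sub>v v)"
    using assms unfolding skew_mat_def by (intro comm_scalar_prod[of _ n]) auto
  then show ?thesis using skew_scalar_prod[OF assms assms(2)] by simp
qed

text \<open>Real and imaginary parts of a complex eigenvector span a \<open>K\<close>-invariant real
  subspace. Skewness makes the eigenvalue purely imaginary: if it is 0, one of the parts is a kernel
  vector; otherwise the parts are orthogonal and equally long.\<close>

lemma skew_eigenpair: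
  assumes K: "skew_mat n K" and n: "0 < n"
  obtains (kernel) x where "x \<in> carrier_vec n" "x \<bullet> x = 1" "K *\<^sub>v x = 0\<^sub>v n"
  | (pair) x y \<mu> where "x \<in> carrier_vec n" "x \<bullet> x = 1" "y \<in> carrier_vec n" "y \<bullet> y = 1" "x \<bullet> y = 0"
      "K *\<^sub>v x = - \<mu> \<cdot>\<^sub>v y" "K *\<^sub>v y = \<mu> \<cdot>\<^sub>v x"
proof -
  have Kc: "K \<in> carrier_mat n n" using K skew_mat_def by auto
  obtain l where "l \<in> spectrum (cmat K)"
    using spectrum_non_empty[of "cmat K" n] Kc n by auto
  then obtain z where z: "z \<in> carrier_vec n" "z \<noteq> 0\<^sub>v n" "cmat K *\<^sub>v z = l \<cdot>\<^sub>v z"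
    using Kc unfolding spectrum_def eigenvalue_def eigenvector_def by auto
  define x y where "x = map_vec Re z" and "y = map_vec Im z"
  define a b where "a = Re l" and "b = Im l"
  have xy: "x \<in> carrier_vec n" "y \<in> carrier_vec n" using z unfolding x_def y_def by auto
  have row: "(\<Sum>j = 0..<n. complex_of_real (K $$ (i, j)) * z $ j) = l * z $ i" if "i < n" for i
    using arg_cong[OF z(3), of "\<lambda>v. v $ i"] that Kc z(1) by (simp add: scalar_prod_def)
  have Kx: "K *\<^sub>v x = a \<cdot>\<^sub>v x - b \<cdot>\<^sub>v y"
  proof (rule eq_vecI)
    fix i assume "i < dim_vec (a \<cdot>\<^sub>v x - b \<cdot>\<^sub>v y)"
    then have "i < n" using xy by simp
    then show "(K *\<^sub>v x) $ i = (a \<cdot>\<^sub>v x - b \<cdot>\<^sub>v y) $ i"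
      using arg_cong[OF row, of i Re] Kc z(1) by (simp add: scalar_prod_def x_def y_def a_def b_def)
  qed (use Kc xy in auto)
  have Ky: "K *\<^sub>v y = b \<cdot>\<^sub>v x + a \<cdot>\<^sub>v y"
  proof (rule eq_vecI)
    fix i assume "i < dim_vec (b \<cdot>\<^sub>v x + a \<cdot>\<^sub>v y)"
    then have "i < n" using xy by simp
    then show "(K *\<^sub>v y) $ i = (b \<cdot>\<^sub>v x + a \<cdot>\<^sub>v y) $ i"
      using arg_cong[OF row, of i Im] Kc z(1) by (simp add: scalar_prod_def x_def y_def a_def b_def)
  qed (use Kc xy in auto)
  have comm: "y \<bullet> x = x \<bullet> y" using xy by (rule comm_scalar_prod[rotated])
  have nz: "x \<noteq> 0\<^sub>v n \<or> y \<noteq> 0\<^sub>v n"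
  proof (rule ccontr)
    assume "\<not> ?thesis"
    then have "x $ i = 0 \<and> y $ i = 0" if "i < n" for i using that by simp
    then have "z $ i = 0" if "i < n" for i
      using that z(1) unfolding x_def y_def by (simp add: complex_eq_iff)
    then show False using z(1,2) by (metis carrier_vecD eq_vecI index_zero_vec(1,2))
  qed
  have nonneg: "0 \<le> v \<bullet> v" if "v \<in> carrier_vec n" for v :: "real vec"
    using that by (simp add: scalar_prod_def sum_nonneg)
  have pos: "0 < x \<bullet> x + y \<bullet> y"
    using nz scalar_prod_self_pos[OF xy(1)] scalar_prod_self_pos[OF xy(2)] nonneg[OF xy(1)] nonneg[OF xy(2)]
    by linarith
  \<comment> \<open>Both equations say that a vector is orthogonal to its image under
    \<open>K\<close>. The mixed terms cancel in their sum, which leaves \<open>a\<close> times a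
    positive number.\<close>
  have 1: "a * (x \<bullet> x) - b * (x \<bullet> y) = 0"
    using skew_scalar_prod_self[OF K xy(1)] xy unfolding Kx by (simp add: scalar_prod_minus_distrib[of _ n])
  have 2: "b * (x \<bullet> y) + a * (y \<bullet> y) = 0"
    using skew_scalar_prod_self[OF K xy(2)] xy comm unfolding Ky by (simp add: scalar_prod_add_distrib[of _ n])
  have "a * (x \<bullet> x + y \<bullet> y) = 0" using 1 2 by (simp add: algebra_simps)
  with pos have a: "a = 0" by simp
  show thesis
  proof (cases "b = 0")
    case True
    have Kx0: "K *\<^sub>v x = 0\<^sub>v n" unfolding Kx a True using xy by (intro eq_vecI) auto
    have Ky0: "K *\<^sub>v y = 0\<^sub>v n" unfolding Ky a True using xy by (intro eq_vecI) auto
    from nz obtain w where w: "w \<in> carrier_vec n" "w \<noteq> 0\<^sub>v n" "K *\<^sub>v w = 0\<^sub>v n"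
      using Kx0 Ky0 xy by auto
    obtain c where c: "(c \<cdot>\<^sub>v w) \<bullet> (c \<cdot>\<^sub>v w) = 1" by (rule normalize_vec[OF w(1,2)])
    have "K *\<^sub>v (c \<cdot>\<^sub>v w) = 0\<^sub>v n"
      using mult_mat_vec[OF Kc w(1)] w(3) by (intro eq_vecI) auto
    with c w(1) show thesis by (intro kernel[of "c \<cdot>\<^sub>v w"]) auto
  next
    case False
    have xy0: "x \<bullet> y = 0" using 1 a False by simp
    \<comment> \<open>Skewness applied to the pair \<open>x\<close>, \<open>y\<close> compares the
      two lengths, so that one factor \<open>c\<close> normalizes both vectors.\<close>
    have "b * (x \<bullet> x) = b * (y \<bullet> y)"
      using skew_scalar_prod[OF K xy] xy xy0 comm unfolding Kx Ky a
      by (simp add: scalar_prod_add_distrib[of _ n] minus_scalar_prod_distrib[of _ n])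
    with False have eq: "x \<bullet> x = y \<bullet> y" by simp
    with pos have "x \<noteq> 0\<^sub>v n" using xy by auto
    with xy(1) obtain c where c: "c * c * (x \<bullet> x) = 1" by (rule normalize_vec)
    show thesis
    proof (rule pair[of "c \<cdot>\<^sub>v x" "c \<cdot>\<^sub>v y" b])
      show "K *\<^sub>v (c \<cdot>\<^sub>v x) = - b \<cdot>\<^sub>v (c \<cdot>\<^sub>v y)"
        unfolding mult_mat_vec[OF Kc xy(1)] Kx a using xy by (intro eq_vecI) auto
      show "K *\<^sub>v (c \<cdot>\<^sub>v y) = b \<cdot>\<^sub>v (c \<cdot>\<^sub>v x)"
        unfolding mult_mat_vec[OF Kc xy(2)] Ky a using xy by (intro eq_vecI) auto
    qed (use xy c eq xy0 in auto)
  qed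
qed

text \<open>Transposition preserves the determinant while negation in odd size changes its sign, so
  \<open>K\<close> is singular.\<close>

lemma skew_odd_kernel:
  assumes K: "skew_mat n K" and n: "odd n"
  obtains x where "x \<in> carrier_vec n" "x \<bullet> x = 1" "K *\<^sub>v x = 0\<^sub>v n"
proof -
  have Kc: "K \<in> carrier_mat n n" and Kt: "transpose_mat K = - K" using K skew_mat_def by auto
  have "- K = (-1) \<cdot>\<^sub>m K" by (intro eq_matI) auto
  then have "det K = (-1) ^ n * det K"
    using det_transpose[OF Kc] Kt Kc det_smult[of "-1" K] by simp
  then have "det K = 0" using n by simp
  then obtain w where w: "w \<in> carrier_vec n" "w \<noteq> 0\<^sub>v n" "K *\<^sub>v w = 0\<^sub>v n"
    using det_0_iff_vec_prod_zero[OF Kc] by auto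
  obtain c where c: "(c \<cdot>\<^sub>v w) \<bullet> (c \<cdot>\<^sub>v w) = 1" by (rule normalize_vec[OF w(1,2)])
  have "K *\<^sub>v (c \<cdot>\<^sub>v w) = 0\<^sub>v n"
    using mult_mat_vec[OF Kc w(1)] w(3) by (intro eq_vecI) auto
  with c w(1) show thesis by (intro that[of "c \<cdot>\<^sub>v w"]) auto
qed

lemma skew_mat_congruence:
  assumes K: "skew_mat n K" and P: "P \<in> carrier_mat n n"
  shows "skew_mat n (transpose_mat P * K * P)"
proof -
  have Kc: "K \<in> carrier_mat n n" and Kt: "transpose_mat K = - K" using K skew_mat_def by auto
  have "transpose_mat (transpose_mat P * K * P) = transpose_mat P * (- K) * P"
    using Kc P Kt by (simp add: transpose_mult[of _ n n _ n] assoc_mult_mat[of _ n n _ n _ n])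
  also have "\<dots> = - (transpose_mat P * K * P)"
    using Kc P by simp
  finally show ?thesis using Kc P unfolding skew_mat_def by auto
qed

text \<open>Both \<open>Q\<close> and its transpose are isometries, so lengths before and after
  applying \<open>K\<close> are unchanged.\<close>

lemma strict_contraction_orthogonal:
  assumes K: "K \<in> carrier_mat n n" "strict_contraction n K"
    and Q: "Q \<in> carrier_mat n n" "transpose_mat Q * Q = 1\<^sub>m n"
  shows "strict_contraction n (transpose_mat Q * K * Q)"
  unfolding strict_contraction_def
proof (intro ballI impI)
  fix v :: "real vec" assume v: "v \<in> carrier_vec n" "v \<noteq> 0\<^sub>v n"
  have "Q * transpose_mat Q = 1\<^sub>m n"
    by (rule mat_mult_left_right_inverse[OF _ Q]) (use Q in simp)
  then have Qt: "transpose_mat (transpose_mat Q) * transpose_mat Q = 1\<^sub>m n" by simp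
  have Qv: "(Q *\<^sub>v v) \<bullet> (Q *\<^sub>v v) = v \<bullet> v" by (rule orthogonal_scalar_prod[OF Q v(1) v(1)])
  then have "Q *\<^sub>v v \<noteq> 0\<^sub>v n" using scalar_prod_self_pos[OF v] by auto
  then have "(K *\<^sub>v (Q *\<^sub>v v)) \<bullet> (K *\<^sub>v (Q *\<^sub>v v)) < v \<bullet> v"
    using K(2) Q v(1) Qv unfolding strict_contraction_def by (metis mult_mat_vec_carrier)
  moreover have "transpose_mat Q * K * Q *\<^sub>v v = transpose_mat Q *\<^sub>v (K *\<^sub>v (Q *\<^sub>v v))"
    using K Q v by (simp add: assoc_mult_mat_vec[of _ n n _ n])
  moreover have "(transpose_mat Q *\<^sub>v (K *\<^sub>v (Q *\<^sub>v v))) \<bullet> (transpose_mat Q *\<^sub>v (K *\<^sub>v (Q *\<^sub>v v)))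
      = (K *\<^sub>v (Q *\<^sub>v v)) \<bullet> (K *\<^sub>v (Q *\<^sub>v v))"
    using K Q v by (intro orthogonal_scalar_prod[OF _ Qt]) auto
  ultimately show "(transpose_mat Q * K * Q *\<^sub>v v) \<bullet> (transpose_mat Q * K * Q *\<^sub>v v) < v \<bullet> v"
    by simp
qed

text \<open>The first \<open>k\<close> columns vanish below \<open>D\<close>, and skewness then
  clears the block to the right of \<open>D\<close>. Padding a vector with \<open>k\<close> zeros
  hands the contraction bound down to \<open>L\<close>.\<close>

lemma skew_deflate:
  assumes M: "skew_mat (k + m) M" "strict_contraction (k + m) M" and D: "D \<in> carrier_mat k k"
    and cols: "\<And>i j. i < k + m \<Longrightarrow> j < k \<Longrightarrow> M $$ (i, j) = (if i < k then D $$ (i, j) else 0)"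
  obtains L where "M = dsum D L" "skew_mat m L" "strict_contraction m L"
proof -
  have Mc: "M \<in> carrier_mat (k + m) (k + m)" and Mt: "transpose_mat M = - M"
    using M skew_mat_def by auto
  have Mij: "M $$ (j, i) = - M $$ (i, j)" if "i < k + m" "j < k + m" for i j
    using arg_cong[OF Mt, of "\<lambda>A. A $$ (i, j)"] that Mc by simp
  define L where "L = mat m m (\<lambda>(i, j). M $$ (i + k, j + k))"
  have L: "L \<in> carrier_mat m m" unfolding L_def by simp
  have block: "M = dsum D L"
  proof (rule eq_matI)
    fix i j assume "i < dim_row (dsum D L)" "j < dim_col (dsum D L)"
    then have ij: "i < k + m" "j < k + m" using D L by auto
    show "M $$ (i, j) = dsum D L $$ (i, j)"
    proof (cases "j < k")
      case True
      then show ?thesis using ij cols[of i j] D L by simp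
    next
      case False
      \<comment> \<open>For \<open>i < k\<close> the entry is minus its mirror image, which lies in
        one of the known columns and is 0 there.\<close>
      then show ?thesis using ij cols[of j i] Mij[of j i] D L by (simp add: L_def)
    qed
  qed (use Mc D L in auto)
  have skew: "skew_mat m L"
    unfolding skew_mat_def
  proof
    show "transpose_mat L = - L"
    proof (rule eq_matI)
      fix i j assume "i < dim_row (- L)" "j < dim_col (- L)"
      then show "transpose_mat L $$ (i, j) = (- L) $$ (i, j)"
        using Mij[of "i + k" "j + k"] L by (simp add: L_def)
    qed (use L in auto)
  qed (rule L)
  have "strict_contraction m L"
    unfolding strict_contraction_def
  proof (intro ballI impI)
    fix v :: "real vec" assume v: "v \<in> carrier_vec m" "v \<noteq> 0\<^sub>v m"
    define w where "w = 0\<^sub>v k @\<^sub>v v"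
    have w: "w \<in> carrier_vec (k + m)" using v w_def by auto
    have "w \<noteq> 0\<^sub>v (k + m)"
    proof
      assume "w = 0\<^sub>v (k + m)"
      then have "w $ (k + i) = 0" if "i < m" for i using that by simp
      then have "v $ i = 0" if "i < m" for i using that v unfolding w_def by simp
      then show False using v by auto
    qed
    then have "(M *\<^sub>v w) \<bullet> (M *\<^sub>v w) < w \<bullet> w"
      using M(2) w unfolding strict_contraction_def by auto
    moreover have "M *\<^sub>v w = 0\<^sub>v k @\<^sub>v (L *\<^sub>v v)"
    proof -
      have "D *\<^sub>v 0\<^sub>v k = 0\<^sub>v k" using D by (intro eq_vecI) auto
      then show ?thesis
        unfolding block w_def dsum_mult_append_vec[OF D L zero_carrier_vec v(1)] by simp
    qed
    moreover have "(0\<^sub>v k @\<^sub>v u) \<bullet> (0\<^sub>v k @\<^sub>v u) = u \<bullet> u" if "u \<in> carrier_vec m" for u :: "real vec"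
      using that by (subst scalar_prod_append[of _ k _ m]) auto
    ultimately show "(L *\<^sub>v v) \<bullet> (L *\<^sub>v v) < v \<bullet> v"
      using v L unfolding w_def by simp
  qed
  with block skew show thesis by (rule that)
qed

section \<open>Congruence to the squared block matrix\<close>

abbreviation cplx_mat :: "real mat \<Rightarrow> real mat \<Rightarrow> complex mat" where
  "cplx_mat S A \<equiv> cmat S + \<i> \<cdot>\<^sub>m cmat A"

text \<open>A real \<open>P\<close> does not mix real and imaginary parts.\<close>

lemma cplx_mat_congruence:
  assumes S: "S \<in> carrier_mat n n" and A: "A \<in> carrier_mat n n" and P: "P \<in> carrier_mat n n"
  shows "transpose_mat (cmat P) * cplx_mat S A * cmat P
    = cplx_mat (transpose_mat P * S * P) (transpose_mat P * A * P)"
proof -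
  have hom: "cmat (transpose_mat P * X * P) = transpose_mat (cmat P) * cmat X * cmat P"
    if "X \<in> carrier_mat n n" for X
    using P that by (simp add: of_real_hom.mat_hom_mult[of _ n n _ n] cmat_transpose)
  show ?thesis
    unfolding hom[OF S] hom[OF A] using S A P
    by (simp add: mult_add_distrib_mat[of _ n n _ n] add_mult_distrib_mat[of _ n n _ _ n]
        mult_smult_distrib[of _ n n _ n] mult_smult_assoc_mat[of _ n n _ n])
qed

lemma cplx_mat_dsum:
  assumes "A \<in> carrier_mat k k" "B \<in> carrier_mat m m" "C \<in> carrier_mat k k" "D \<in> carrier_mat m m"
  shows "cplx_mat (dsum A B) (dsum C D) = dsum (cplx_mat A C) (cplx_mat B D)"
  using assms by (intro eq_matI) auto

section \<open>The hyperbolic blocks and the recursion for the block matrix\<close>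

lemma B_block_carrier: "B_block t \<in> carrier_mat 2 2"
  unfolding B_block_def by (auto simp: mat_of_rows_list_def)

lemma B_block_index:
  "B_block t $$ (0, 0) = cosh t" "B_block t $$ (0, 1) = \<i> * sinh t"
  "B_block t $$ (1, 0) = - \<i> * sinh t" "B_block t $$ (1, 1) = cosh t"
  "B_block t $$ (0, Suc 0) = \<i> * sinh t"
  "B_block t $$ (Suc 0, 0) = - \<i> * sinh t" "B_block t $$ (Suc 0, Suc 0) = cosh t"
  unfolding B_block_def by (auto simp: mat_of_rows_list_def)

lemma eq_mat2I:
  assumes "A \<in> carrier_mat 2 2" "B \<in> carrier_mat 2 2"
    and "A $$ (0, 0) = B $$ (0, 0)" "A $$ (0, 1) = B $$ (0, 1)"
      "A $$ (1, 0) = B $$ (1, 0)" "A $$ (1, 1) = B $$ (1, 1)"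
  shows "A = B"
  using assms by (intro eq_matI) (auto dest!: less_2_cases)

text \<open>\<open>B_block t\<close> is the exponential of \<open>t J\<close> for the Hermitian
  involution \<open>J\<close> with off-diagonal entries \<open>\<i>\<close> and
  \<open>- \<i>\<close>; in coordinates the group law is the addition theorem for cosh and
  sinh.\<close>

lemma B_block_mult: "B_block s * B_block t = B_block (s + t)"
proof (rule eq_mat2I)
  note [simp] = B_block_carrier[THEN carrier_matD(1)] B_block_carrier[THEN carrier_matD(2)]
    B_block_index scalar_prod_def cosh_add sinh_add numeral_2_eq_2
  have ii: "\<i> * (x * (\<i> * y)) = - (x * y)" for x y
    by (metis complex_i_mult_minus mult.commute mult.left_commute mult_minus_left)
  show "(B_block s * B_block t) $$ (0, 0) = B_block (s + t) $$ (0, 0)"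
    "(B_block s * B_block t) $$ (0, 1) = B_block (s + t) $$ (0, 1)"
    "(B_block s * B_block t) $$ (1, 0) = B_block (s + t) $$ (1, 0)"
    "(B_block s * B_block t) $$ (1, 1) = B_block (s + t) $$ (1, 1)"
    by (simp_all add: algebra_simps ii)
qed (auto intro: B_block_carrier mult_carrier_mat)

lemma B_block_0: "B_block 0 = 1\<^sub>m 2"
  by (rule eq_mat2I) (simp_all add: B_block_carrier B_block_index)

lemma B_mat_even_Nil: "even n \<Longrightarrow> B_mat n [] = 1\<^sub>m 0"
  unfolding B_mat_def by auto

lemma B_mat_even_Cons: "even n \<Longrightarrow> B_mat n (t # ts) = dsum (B_block t) (B_mat n ts)"
  unfolding B_mat_def by (simp add: Let_def)

text \<open>Splitting off the leading 1 of an odd-sized matrix leaves a matrix of even size, on which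
  \<^term>\<open>B_mat\<close> does not depend; 0 serves as the canonical even size.\<close>
lemma B_mat_odd: "odd n \<Longrightarrow> B_mat n ts = dsum (1\<^sub>m 1) (B_mat 0 ts)"
  unfolding B_mat_def by (simp add: Let_def)

lemma B_mat_even: "even n \<Longrightarrow> B_mat n ts = B_mat 0 ts"
  unfolding B_mat_def by simp

lemma B_mat_0_carrier: "B_mat 0 ts \<in> carrier_mat (2 * length ts) (2 * length ts)"
proof (induction ts)
  case (Cons t ts)
  then show ?case
    using B_mat_even_Cons[of 0 t ts] B_block_carrier[of t]
      four_block_carrier_mat[of "B_block t" 2 2 "B_mat 0 ts" "2 * length ts" "2 * length ts"]
    by simp
qed (simp add: B_mat_even_Nil)

lemma B_mat_carrier:
  assumes "length ts = n div 2"
  shows "B_mat n ts \<in> carrier_mat n n"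
proof (cases "even n")
  case True
  then show ?thesis using assms B_mat_0_carrier[of ts] B_mat_even[of n ts] by simp
next
  case False
  then have "Suc (2 * length ts) = n" using assms by presburger
  then show ?thesis
    using False B_mat_0_carrier[of ts] B_mat_odd[of n ts]
      four_block_carrier_mat[of "1\<^sub>m 1" 1 1 "B_mat 0 ts" "2 * length ts" "2 * length ts"]
    by simp
qed

lemma B_mat_Suc_even: "even m \<Longrightarrow> B_mat (Suc m) ts = dsum (1\<^sub>m 1) (B_mat m ts)"
  using B_mat_odd[of "Suc m" ts] B_mat_even[of m ts] by simp

text \<open>The new 1 and the leading 1 of the odd-sized matrix merge into an identity of size 2,
  which is the block with parameter 0.\<close>

lemma B_mat_Suc_odd: "odd m \<Longrightarrow> B_mat (Suc m) (0 # ts) = dsum (1\<^sub>m 1) (B_mat m ts)"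
proof -
  assume m: "odd m"
  have "dsum (1\<^sub>m 2) X = dsum (1\<^sub>m 1) (dsum (1\<^sub>m 1) X)" for X :: "complex mat"
    by (intro eq_matI) (auto simp: numeral_2_eq_2)
  then show ?thesis
    using m B_mat_even_Cons[of "Suc m" 0 ts] B_mat_odd[of m ts] B_mat_even[of "Suc m" ts]
    by (simp add: B_block_0)
qed

section \<open>Deflation step and induction for skew-symmetric contractions\<close>

lemma mat_index_unit_vec:
  fixes A :: "real mat"
  assumes "A \<in> carrier_mat m n" "i < m" "j < n"
  shows "A $$ (i, j) = (A *\<^sub>v unit_vec n j) $ i"
  using assms by simp

text \<open>Serves invariant lines and invariant planes alike: the first \<open>k\<close> columns of
  \<open>Q\<close> span an invariant subspace on which \<open>K\<close> acts by \<open>D\<close>.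
  The squares \<open>C * C\<close> and \<open>E * E\<close> are kept as products, since they combine
  into the square of one direct sum.\<close>

lemma skew_deflation_step:
  assumes K: "skew_mat (k + m) K" "strict_contraction (k + m) K"
    and Q: "Q \<in> carrier_mat (k + m) (k + m)" "transpose_mat Q * Q = 1\<^sub>m (k + m)"
    and D: "D \<in> carrier_mat k k"
    and cols: "\<And>i j. i < k + m \<Longrightarrow> j < k \<Longrightarrow>
      (transpose_mat Q *\<^sub>v (K *\<^sub>v (Q *\<^sub>v unit_vec (k + m) j))) $ i = (if i < k then D $$ (i, j) else 0)"
  obtains L where "skew_mat m L" "strict_contraction m L"
    "\<And>C E. C \<in> carrier_mat k k \<Longrightarrow> E \<in> carrier_mat m m \<Longrightarrow>
      real_congruent k (cplx_mat (1\<^sub>m k) D) (C * C) \<Longrightarrow> real_congruent m (cplx_mat (1\<^sub>m m) L) (E * E) \<Longrightarrow>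
      real_congruent (k + m) (cplx_mat (1\<^sub>m (k + m)) K) (dsum C E * dsum C E)"
proof -
  have Kc: "K \<in> carrier_mat (k + m) (k + m)" using K skew_mat_def by auto
  define M where "M = transpose_mat Q * K * Q"
  have Mc: "M \<in> carrier_mat (k + m) (k + m)" using Q Kc unfolding M_def by auto
  have "M $$ (i, j) = (if i < k then D $$ (i, j) else 0)" if "i < k + m" "j < k" for i j
  proof -
    have "M *\<^sub>v unit_vec (k + m) j = transpose_mat Q *\<^sub>v (K *\<^sub>v (Q *\<^sub>v unit_vec (k + m) j))"
      unfolding M_def using Q Kc by (simp add: assoc_mult_mat_vec[of _ "k + m" "k + m" _ "k + m"])
    then show ?thesis
      using cols[OF that] mat_index_unit_vec[OF Mc, of i j] that by simp
  qed
  with skew_mat_congruence[OF K(1) Q(1)] strict_contraction_orthogonal[OF Kc K(2) Q] D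
  obtain L where L: "M = dsum D L" "skew_mat m L" "strict_contraction m L"
    unfolding M_def[symmetric] by (rule skew_deflate) auto
  have Lc: "L \<in> carrier_mat m m" using L skew_mat_def by auto
  show thesis
  proof (rule that[OF L(2,3)])
    fix C E assume C: "C \<in> carrier_mat k k" and E: "E \<in> carrier_mat m m"
      and rc: "real_congruent k (cplx_mat (1\<^sub>m k) D) (C * C)" "real_congruent m (cplx_mat (1\<^sub>m m) L) (E * E)"
    \<comment> \<open>Orthogonality of \<open>Q\<close> keeps the real part equal to the
      identity.\<close>
    have "transpose_mat (cmat Q) * cplx_mat (1\<^sub>m (k + m)) K * cmat Q = cplx_mat (1\<^sub>m (k + m)) M"
      unfolding M_def using Q Kc by (subst cplx_mat_congruence[of _ "k + m"]) auto
    also have "\<dots> = cplx_mat (dsum (1\<^sub>m k) (1\<^sub>m m)) (dsum D L)"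
      unfolding L dsum_one ..
    also have "\<dots> = dsum (cplx_mat (1\<^sub>m k) D) (cplx_mat (1\<^sub>m m) L)"
      using D Lc by (intro cplx_mat_dsum) auto
    finally have eq: "transpose_mat (cmat Q) * cplx_mat (1\<^sub>m (k + m)) K * cmat Q
      = dsum (cplx_mat (1\<^sub>m k) D) (cplx_mat (1\<^sub>m m) L)" .
    have rc1: "real_congruent (k + m) (cplx_mat (1\<^sub>m (k + m)) K) (dsum (cplx_mat (1\<^sub>m k) D) (cplx_mat (1\<^sub>m m) L))"
      unfolding eq[symmetric] using Q Kc det_nonzero_of_right_inverse[OF _ Q(1,2)]
      by (intro real_congruent_of_transform) (auto simp: det_transpose)
    have rc2: "real_congruent (k + m) (dsum (cplx_mat (1\<^sub>m k) D) (cplx_mat (1\<^sub>m m) L)) (dsum (C * C) (E * E))"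
      using C E rc by (intro real_congruent_dsum) auto
    show "real_congruent (k + m) (cplx_mat (1\<^sub>m (k + m)) K) (dsum C E * dsum C E)"
      unfolding dsum_mult[OF C E C E]
      by (rule real_congruent_trans[OF _ rc1 rc2]) (use C E in auto)
  qed
qed

lemma real_congruent_refl:
  assumes "H \<in> carrier_mat n n"
  shows "real_congruent n H H"
  unfolding real_congruent_def using assms
  by (intro bexI[of _ "1\<^sub>m n"]) (auto simp: of_real_hom.mat_hom_one)

text \<open>The square of \<open>B_block t\<close> is \<open>B_block (t + t)\<close>. Dividing it by
  \<open>cosh (t + t)\<close> leaves ones on the diagonal and tanh of \<open>t + t\<close> as the
  off-diagonal parameter, which can be any \<mu> of modulus below 1.\<close>

lemma real_congruent_B_block:
  assumes "\<mu> * \<mu> < 1"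
  obtains t where
    "real_congruent 2 (cplx_mat (1\<^sub>m 2) (mat_of_rows_list 2 [[0, \<mu>], [- \<mu>, 0]])) (B_block t * B_block t)"
proof -
  define D where "D = mat_of_rows_list 2 [[0, \<mu>], [- \<mu>, 0]]"
  have D: "D \<in> carrier_mat 2 2" "D $$ (0, 0) = 0" "D $$ (0, 1) = \<mu>" "D $$ (1, 0) = - \<mu>" "D $$ (1, 1) = 0"
    unfolding D_def by (auto simp: mat_of_rows_list_def)
  have mu: "\<bar>\<mu>\<bar> < 1" using assms abs_square_less_1[of \<mu>] by (simp add: power2_eq_square)
  \<comment> \<open>Half of artanh \<mu>, so that tanh of \<open>t + t\<close> is \<mu>.\<close>
  define t where "t = ln ((1 + \<mu>) / (1 - \<mu>)) / 4"
  define e where "e = exp (t + t)"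
  have "0 < (1 + \<mu>) / (1 - \<mu>)" using mu by auto
  then have "e * e = (1 + \<mu>) / (1 - \<mu>)"
    unfolding e_def t_def exp_add[symmetric] by simp
  then have "e * e * (1 - \<mu>) = 1 + \<mu>" using mu by (simp add: field_simps)
  then have ee: "e * e - 1 = \<mu> * (e * e + 1)" by (simp add: algebra_simps)
  have "0 < e" unfolding e_def by simp
  then have "e - 1 / e = (e * e - 1) / e" "e + 1 / e = (e * e + 1) / e"
    by (simp_all add: field_simps)
  moreover have "sinh (t + t) = (e - 1 / e) / 2" "cosh (t + t) = (e + 1 / e) / 2"
    unfolding e_def sinh_field_def cosh_field_def by (simp_all add: exp_minus field_simps)
  ultimately have sc: "sinh (t + t) = \<mu> * cosh (t + t)"
    using ee by simp
  \<comment> \<open>The congruence is by a scalar matrix, which acts through the square of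
    \<open>d\<close>; hence the root.\<close>
  define d where "d = 1 / sqrt (cosh (t + t))"
  have d: "d \<noteq> 0" "d * d * cosh (t + t) = 1"
    unfolding d_def by (simp_all add: cosh_real_pos less_imp_le)
  let ?V = "d \<cdot>\<^sub>m 1\<^sub>m 2 :: real mat"
  have cV: "cmat ?V = complex_of_real d \<cdot>\<^sub>m 1\<^sub>m 2" by (intro eq_matI) auto
  have "transpose_mat (cmat ?V) * (B_block t * B_block t) * cmat ?V
      = complex_of_real (d * d) \<cdot>\<^sub>m B_block (t + t)"
  proof -
    have tr: "transpose_mat (complex_of_real d \<cdot>\<^sub>m 1\<^sub>m 2) = complex_of_real d \<cdot>\<^sub>m 1\<^sub>m 2"
      by (intro eq_matI) auto
    have "complex_of_real d \<cdot>\<^sub>m (complex_of_real d \<cdot>\<^sub>m X) = complex_of_real (d * d) \<cdot>\<^sub>m X" for X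
      by (intro eq_matI) auto
    then show ?thesis
      unfolding cV B_block_mult tr using B_block_carrier[of "t + t"]
      by (simp add: mult_smult_assoc_mat[of _ 2 2 _ 2] mult_smult_distrib[of _ 2 2 _ 2])
  qed
  also have "\<dots> = cplx_mat (1\<^sub>m 2) D"
  proof -
    have "d * (d * cosh (t + t)) = 1" "d * (d * sinh (t + t)) = \<mu>"
      using d(2) unfolding sc by (simp_all add: mult.assoc mult.left_commute[of _ \<mu>])
    then have "complex_of_real d * (complex_of_real d * complex_of_real (cosh (t + t))) = 1"
      "complex_of_real d * (complex_of_real d * complex_of_real (sinh (t + t))) = complex_of_real \<mu>"
      by (metis of_real_1 of_real_mult)+
    then show ?thesis
      using B_block_carrier[of "t + t"] D
      by (intro eq_mat2I) (simp_all add: B_block_index ac_simps)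
  qed
  finally have "real_congruent 2 (cplx_mat (1\<^sub>m 2) D) (B_block t * B_block t)"
    unfolding real_congruent_def using d(1) by (intro bexI[of _ ?V]) auto
  then show thesis unfolding D_def by (rule that)
qed

text \<open>\<open>\<mu> * \<mu>\<close> is the squared length of the image of the unit vector
  \<open>x\<close>. The bound is what makes artanh \<mu> available.\<close>

lemma strict_contraction_eigenpair:
  assumes "strict_contraction n K" "x \<in> carrier_vec n" "x \<bullet> x = 1" "y \<in> carrier_vec n" "y \<bullet> y = 1"
    and "K *\<^sub>v x = - \<mu> \<cdot>\<^sub>v y"
  shows "\<mu> * \<mu> < 1"
proof -
  have "x \<noteq> 0\<^sub>v n" using assms(2,3) by auto
  then have "(- \<mu> \<cdot>\<^sub>v y) \<bullet> (- \<mu> \<cdot>\<^sub>v y) < 1"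
    using assms unfolding strict_contraction_def by metis
  then show ?thesis using assms(4,5) by simp
qed

text \<open>Induction on the size. A kernel vector of \<open>K\<close> splits off a 1; in even size the remaining
  matrix is odd and its leading 1 pairs up with the new one to the block with parameter 0. In odd
  size a kernel vector always exists, so the eigenvectors are only needed in even size.\<close>
lemma skew_contraction_congruent_B_mat:
  assumes "skew_mat n K" "strict_contraction n K"
  shows "\<exists>ts. length ts = n div 2 \<and>
    real_congruent n (cplx_mat (1\<^sub>m n) K) (B_mat n ts * B_mat n ts)"
  using assms
proof (induction n arbitrary: K rule: less_induct)
  case (less n)
  note K = less.prems
  have Kc: "K \<in> carrier_mat n n" using K skew_mat_def by auto
  \<comment> \<open>Shared by the odd sizes and by the kernel alternative in even sizes.\<close>
  have kernel_case: ?case if n: "0 < n" and x: "x \<in> carrier_vec n" "x \<bullet> x = 1" "K *\<^sub>v x = 0\<^sub>v n" for x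
  proof -
    obtain m where m: "n = 1 + m" using n by (cases n) auto
    obtain Q where Q: "Q \<in> carrier_mat n n" "transpose_mat Q * Q = 1\<^sub>m n" "Q *\<^sub>v unit_vec n 0 = x"
      using orthogonal_extend1[OF x(1,2) n] by auto
    have 0: "transpose_mat Q *\<^sub>v 0\<^sub>v n = 0\<^sub>v n" using Q(1) by (intro eq_vecI) auto
    obtain L where L: "skew_mat m L" "strict_contraction m L"
      and step: "\<And>C E. C \<in> carrier_mat 1 1 \<Longrightarrow> E \<in> carrier_mat m m \<Longrightarrow>
        real_congruent 1 (cplx_mat (1\<^sub>m 1) (0\<^sub>m 1 1)) (C * C) \<Longrightarrow> real_congruent m (cplx_mat (1\<^sub>m m) L) (E * E) \<Longrightarrow>
        real_congruent (1 + m) (cplx_mat (1\<^sub>m (1 + m)) K) (dsum C E * dsum C E)"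
      using K Q(1,2) unfolding m
      by (rule skew_deflation_step[where D = "0\<^sub>m 1 1"]) (use Q(3) x(3) 0 m in auto)
    obtain ts where ts: "length ts = m div 2"
      and rc: "real_congruent m (cplx_mat (1\<^sub>m m) L) (B_mat m ts * B_mat m ts)"
      using less.IH[OF _ L] m by auto
    \<comment> \<open>\<open>K\<close> acts as zero on the line of \<open>x\<close>, so the summand
      that splits off is 1, its own square.\<close>
    have "cplx_mat (1\<^sub>m 1) (0\<^sub>m 1 1) = 1\<^sub>m 1 * 1\<^sub>m 1"
      by (intro eq_matI) auto
    then have "real_congruent 1 (cplx_mat (1\<^sub>m 1) (0\<^sub>m 1 1)) (1\<^sub>m 1 * 1\<^sub>m 1)"
      using real_congruent_refl[of "1\<^sub>m 1" 1] by simp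
    with step[OF _ B_mat_carrier[OF ts] _ rc, of "1\<^sub>m 1"]
    have "real_congruent n (cplx_mat (1\<^sub>m n) K)
        (dsum (1\<^sub>m 1) (B_mat m ts) * dsum (1\<^sub>m 1) (B_mat m ts))"
      unfolding m by simp
    moreover have "dsum (1\<^sub>m 1) (B_mat m ts) = B_mat n (if even m then ts else 0 # ts)"
      using B_mat_Suc_even[of m ts] B_mat_Suc_odd[of m ts] unfolding m by simp
    moreover have "length (if even m then ts else 0 # ts) = n div 2"
      unfolding m using ts by (auto elim: evenE oddE)
    ultimately show ?thesis by metis
  qed
  consider (zero) "n = 0" | (odd) "odd n" | (even) "even n" "0 < n" by auto
  then show ?case
  proof cases
    case zero
    then have "cplx_mat (1\<^sub>m n) K = B_mat n [] * B_mat n []"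
      using Kc B_mat_carrier[of "[]" n] by (intro eq_matI) auto
    then show ?thesis
      using real_congruent_refl[of "B_mat n [] * B_mat n []" n] B_mat_carrier[of "[]" n] zero
      by (intro exI[of _ "[]"]) auto
  next
    case odd
    then obtain x where "x \<in> carrier_vec n" "x \<bullet> x = 1" "K *\<^sub>v x = 0\<^sub>v n"
      using skew_odd_kernel[OF K(1)] by metis
    then show ?thesis using kernel_case odd by (meson odd_pos)
  next
    case even
    from K(1) even(2) show ?thesis
    proof (cases rule: skew_eigenpair)
      case (kernel x)
      then show ?thesis using kernel_case even by metis
    next
      case (pair x y \<mu>)
      obtain m where m: "n = 2 + m" "even m"
        using even by (metis add_2_eq_Suc even_Suc gr0_implies_Suc odd_pos)
      obtain Q where Q: "Q \<in> carrier_mat n n" "transpose_mat Q * Q = 1\<^sub>m n"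
        "Q *\<^sub>v unit_vec n 0 = x" "Q *\<^sub>v unit_vec n 1 = y"
        using orthogonal_extend2[OF pair(1-5)] m(1) by auto
      have Qt: "transpose_mat Q *\<^sub>v (Q *\<^sub>v v) = v" if "v \<in> carrier_vec n" for v
        using that Q(1,2) by (simp flip: assoc_mult_mat_vec[of _ n n _ n])
      define D where "D = mat_of_rows_list 2 [[0, \<mu>], [- \<mu>, 0]]"
      have D: "D \<in> carrier_mat 2 2" unfolding D_def by (auto simp: mat_of_rows_list_def)
      \<comment> \<open>The images \<open>- \<mu> y\<close> and \<open>\<mu> x\<close> of
        \<open>x\<close> and \<open>y\<close> give the first two columns in the new basis; their
        upper part is \<open>D\<close> and the rest is 0.\<close>
      have c0: "transpose_mat Q *\<^sub>v (K *\<^sub>v (Q *\<^sub>v unit_vec n 0)) = - \<mu> \<cdot>\<^sub>v unit_vec n 1"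
      proof -
        have "transpose_mat Q *\<^sub>v (- \<mu> \<cdot>\<^sub>v y) = - \<mu> \<cdot>\<^sub>v (transpose_mat Q *\<^sub>v y)"
          using Q(1) pair(3) by (intro mult_mat_vec) auto
        then show ?thesis using Qt[of "unit_vec n 1"] Q pair by simp
      qed
      have c1: "transpose_mat Q *\<^sub>v (K *\<^sub>v (Q *\<^sub>v unit_vec n 1)) = \<mu> \<cdot>\<^sub>v unit_vec n 0"
      proof -
        have "transpose_mat Q *\<^sub>v (\<mu> \<cdot>\<^sub>v x) = \<mu> \<cdot>\<^sub>v (transpose_mat Q *\<^sub>v x)"
          using Q(1) pair(1) by (intro mult_mat_vec) auto
        then show ?thesis using Qt[of "unit_vec n 0"] Q pair by simp
      qed
      have cols: "(transpose_mat Q *\<^sub>v (K *\<^sub>v (Q *\<^sub>v unit_vec (2 + m) j))) $ i = (if i < 2 then D $$ (i, j) else 0)"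
        if "i < 2 + m" "j < 2" for i j
      proof -
        from that(2) have "j = 0 \<or> j = 1" by auto
        then show ?thesis
          using c0 c1 that(1) unfolding m(1) D_def
          by (auto simp: mat_of_rows_list_def dest!: less_2_cases)
      qed
      obtain L where L: "skew_mat m L" "strict_contraction m L"
        and step: "\<And>C E. C \<in> carrier_mat 2 2 \<Longrightarrow> E \<in> carrier_mat m m \<Longrightarrow>
          real_congruent 2 (cplx_mat (1\<^sub>m 2) D) (C * C) \<Longrightarrow> real_congruent m (cplx_mat (1\<^sub>m m) L) (E * E) \<Longrightarrow>
          real_congruent (2 + m) (cplx_mat (1\<^sub>m (2 + m)) K) (dsum C E * dsum C E)"
        using K Q(1,2) D cols unfolding m(1) by (rule skew_deflation_step) auto
      obtain ts where ts: "length ts = m div 2"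
        and rc: "real_congruent m (cplx_mat (1\<^sub>m m) L) (B_mat m ts * B_mat m ts)"
        using less.IH[OF _ L] m by auto
      obtain t where "real_congruent 2 (cplx_mat (1\<^sub>m 2) D) (B_block t * B_block t)"
        using real_congruent_B_block[OF strict_contraction_eigenpair[OF K(2) pair(1-4,6)]]
        unfolding D_def by auto
      from step[OF B_block_carrier B_mat_carrier[OF ts] this rc]
      have "real_congruent n (cplx_mat (1\<^sub>m n) K) (B_mat n (t # ts) * B_mat n (t # ts))"
        using B_mat_even_Cons[of n t ts] B_mat_even[of n ts] B_mat_even[of m ts] m by simp
      moreover have "length (t # ts) = n div 2" using ts m by simp
      ultimately show ?thesis by metis
    qed
  qed
qed

section \<open>Cholesky factorization and positive definite matrices\<close>

text \<open>Induction by eliminating the first row and column: \<open>S\<close> is congruent to the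
  direct sum of its corner entry \<open>a\<close> and the Schur complement \<open>T\<close>, which
  is again symmetric and positive definite.\<close>

lemma cholesky:
  fixes S :: "real mat"
  assumes "S \<in> carrier_mat n n" "transpose_mat S = S"
    and "\<And>x. x \<in> carrier_vec n \<Longrightarrow> x \<noteq> 0\<^sub>v n \<Longrightarrow> 0 < x \<bullet> (S *\<^sub>v x)"
  shows "\<exists>W\<in>carrier_mat n n. det W \<noteq> 0 \<and> S = transpose_mat W * W"
  using assms
proof (induction n arbitrary: S)
  case 0
  then show ?case by (intro bexI[of _ "1\<^sub>m 0"]) (auto intro!: eq_matI)
next
  case (Suc m)
  note S = Suc.prems
  have sym: "S $$ (i, j) = S $$ (j, i)" if "i < Suc m" "j < Suc m" for i j
    using arg_cong[OF S(2), of "\<lambda>A. A $$ (i, j)"] that S(1) by simp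
  define a where "a = S $$ (0, 0)"
  have "0 < unit_vec (Suc m) 0 \<bullet> (S *\<^sub>v unit_vec (Suc m) 0)"
    by (rule S(3)) (auto simp: vec_eq_iff)
  then have a: "a > 0" unfolding a_def using S(1) by simp
  \<comment> \<open>\<open>L\<close> is the unit upper triangular elimination matrix with first row
    \<open>(1, r)\<close>; \<open>T\<close> is the Schur complement of \<open>a\<close>.\<close>
  define r where "r = mat 1 m (\<lambda>(_, j). S $$ (0, Suc j) / a)"
  define T where "T = mat m m (\<lambda>(i, j). S $$ (Suc i, Suc j) - S $$ (0, Suc i) * S $$ (0, Suc j) / a)"
  define L where "L = four_block_mat (1\<^sub>m 1) r (0\<^sub>m m 1) (1\<^sub>m m)"
  have r: "r \<in> carrier_mat 1 m" and T: "T \<in> carrier_mat m m" unfolding r_def T_def by auto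
  have L: "L \<in> carrier_mat (1 + m) (1 + m)" unfolding L_def by auto
  have detL: "det L = 1"
    unfolding L_def using r by (subst det_four_block_mat_lower_left_zero[of _ 1 _ m]) auto
  have A: "a \<cdot>\<^sub>m 1\<^sub>m 1 \<in> carrier_mat 1 1" by simp
  have Lt: "transpose_mat L = four_block_mat (1\<^sub>m 1) (0\<^sub>m 1 m) (transpose_mat r) (1\<^sub>m m)"
    unfolding L_def using r by (subst transpose_four_block_mat[of _ 1 1 _ m _ m]) auto
  have "transpose_mat L * dsum (a \<cdot>\<^sub>m 1\<^sub>m 1) T * L
      = four_block_mat (a \<cdot>\<^sub>m 1\<^sub>m 1) (a \<cdot>\<^sub>m r) (a \<cdot>\<^sub>m transpose_mat r) (a \<cdot>\<^sub>m (transpose_mat r * r) + T)"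
    unfolding Lt unfolding L_def using r T
    by (simp add: mult_four_block_mat[of _ 1 1 _ m _ m _ _ 1 _ m] mult_smult_distrib[of _ m 1 _ 1]
        mult_smult_assoc_mat[of _ m 1 _ m] mult_smult_assoc_mat[of _ 1 1 _ m])
  also have "\<dots> = S"
  proof (rule eq_matI)
    fix i j assume "i < dim_row S" "j < dim_col S"
    then have ij: "i < Suc m" "j < Suc m" using S(1) by auto
    then show "four_block_mat (a \<cdot>\<^sub>m 1\<^sub>m 1) (a \<cdot>\<^sub>m r) (a \<cdot>\<^sub>m transpose_mat r) (a \<cdot>\<^sub>m (transpose_mat r * r) + T) $$ (i, j) = S $$ (i, j)"
      using a sym[of i 0] r T
      by (cases i; cases j) (auto simp: r_def T_def a_def scalar_prod_def)
  qed (use S(1) r T in auto)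
  finally have SL: "transpose_mat L * dsum (a \<cdot>\<^sub>m 1\<^sub>m 1) T * L = S" .
  \<comment> \<open>The form of \<open>T\<close> at \<open>y\<close> is the form of \<open>S\<close>
    at the preimage of \<open>(0, y)\<close> under \<open>L\<close>.\<close>
  have Tpos: "0 < y \<bullet> (T *\<^sub>v y)" if y: "y \<in> carrier_vec m" "y \<noteq> 0\<^sub>v m" for y
  proof -
    obtain N where N: "N \<in> carrier_mat (1 + m) (1 + m)" "L * N = 1\<^sub>m (1 + m)"
      using inverse_mat_obtain[OF L] detL by auto
    define x where "x = N *\<^sub>v (0\<^sub>v 1 @\<^sub>v y)"
    have y': "0\<^sub>v 1 @\<^sub>v y \<in> carrier_vec (1 + m)"
      by (rule append_carrier_vec) (use y in auto)
    have x: "x \<in> carrier_vec (1 + m)" using N y' unfolding x_def by auto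
    have Lx: "L *\<^sub>v x = 0\<^sub>v 1 @\<^sub>v y"
      unfolding x_def using N L y' by (simp flip: assoc_mult_mat_vec[of _ "1 + m" "1 + m" _ "1 + m"])
    have "x \<noteq> 0\<^sub>v (1 + m)"
    proof
      assume "x = 0\<^sub>v (1 + m)"
      then have "L *\<^sub>v x = 0\<^sub>v (1 + m)" using L by (intro eq_vecI) auto
      then have "(0\<^sub>v 1 @\<^sub>v y) $ (1 + i) = 0" if "i < m" for i using that unfolding Lx by simp
      then have "y $ i = 0" if "i < m" for i using that y by simp
      then show False using y by auto
    qed
    then have "0 < x \<bullet> (S *\<^sub>v x)" using S(3) x by simp
    also have "S *\<^sub>v x = transpose_mat L *\<^sub>v (dsum (a \<cdot>\<^sub>m 1\<^sub>m 1) T *\<^sub>v (0\<^sub>v 1 @\<^sub>v y))"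
      unfolding Lx[symmetric] SL[symmetric] using L x T
        four_block_carrier_mat[OF A T, of "0\<^sub>m (dim_row (a \<cdot>\<^sub>m 1\<^sub>m 1)) (dim_col T)" "0\<^sub>m (dim_row T) (dim_col (a \<cdot>\<^sub>m 1\<^sub>m 1))"]
      by (simp only: assoc_mult_mat_vec[of _ "1 + m" "1 + m" _ "1 + m"] transpose_carrier_mat mult_mat_vec_carrier mult_carrier_mat)
    also have "dsum (a \<cdot>\<^sub>m 1\<^sub>m 1) T *\<^sub>v (0\<^sub>v 1 @\<^sub>v y) = 0\<^sub>v 1 @\<^sub>v (T *\<^sub>v y)"
    proof -
      have "a \<cdot>\<^sub>m 1\<^sub>m 1 *\<^sub>v 0\<^sub>v 1 = 0\<^sub>v 1" by (intro eq_vecI) auto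
      then show ?thesis unfolding dsum_mult_append_vec[OF A T zero_carrier_vec y(1)] by simp
    qed
    also have "x \<bullet> (transpose_mat L *\<^sub>v (0\<^sub>v 1 @\<^sub>v (T *\<^sub>v y))) = (0\<^sub>v 1 @\<^sub>v (T *\<^sub>v y)) \<bullet> (L *\<^sub>v x)"
    proof -
      have Ty: "0\<^sub>v 1 @\<^sub>v (T *\<^sub>v y) \<in> carrier_vec (1 + m)"
        by (rule append_carrier_vec) (use T y in auto)
      then show ?thesis
        using transpose_vec_mult_scalar[OF L x Ty] comm_scalar_prod[OF x, of "transpose_mat L *\<^sub>v (0\<^sub>v 1 @\<^sub>v (T *\<^sub>v y))"] L
        by (metis mult_mat_vec_carrier transpose_carrier_mat)
    qed
    also have "\<dots> = (T *\<^sub>v y) \<bullet> y"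
      unfolding Lx using T y by (subst scalar_prod_append[of _ 1 _ m]) auto
    also have "\<dots> = y \<bullet> (T *\<^sub>v y)" using T y by (intro comm_scalar_prod[of _ m]) auto
    finally show ?thesis .
  qed
  have "transpose_mat T = T"
    unfolding T_def using sym by (intro eq_matI) auto
  from Suc.IH[OF T this Tpos] obtain W where W: "W \<in> carrier_mat m m" "det W \<noteq> 0" "T = transpose_mat W * W"
    by auto
  \<comment> \<open>A factor of the direct sum of \<open>a\<close> and \<open>T\<close>; multiplied
    by \<open>L\<close> it yields the factor of \<open>S\<close>.\<close>
  define V where "V = dsum (sqrt a \<cdot>\<^sub>m 1\<^sub>m 1) W"
  have V: "V \<in> carrier_mat (1 + m) (1 + m)" unfolding V_def using W by auto
  have sq: "sqrt a \<cdot>\<^sub>m 1\<^sub>m 1 \<in> carrier_mat 1 1" by simp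
  have detV: "det V \<noteq> 0"
    unfolding V_def dsum_det[OF sq W(1)] using a W by simp
  have "transpose_mat V * V = dsum (a \<cdot>\<^sub>m 1\<^sub>m 1) T"
  proof -
    have "transpose_mat (sqrt a \<cdot>\<^sub>m 1\<^sub>m 1) * (sqrt a \<cdot>\<^sub>m 1\<^sub>m 1) = a \<cdot>\<^sub>m 1\<^sub>m 1"
      using a by (intro eq_matI) (auto simp: scalar_prod_def)
    then show ?thesis
      unfolding V_def dsum_transpose[OF sq W(1)] W(3)
      by (subst dsum_mult[of _ 1 _ m]) (use W in auto)
  qed
  moreover have "transpose_mat (V * L) * (V * L) = transpose_mat L * (transpose_mat V * V) * L"
    using V L by (simp add: transpose_mult[of _ "Suc m" "Suc m" _ "Suc m"]
        assoc_mult_mat[of _ "Suc m" "Suc m" _ "Suc m" _ "Suc m"])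
  ultimately have "S = transpose_mat (V * L) * (V * L)" using SL by simp
  moreover have "det (V * L) \<noteq> 0" using det_mult[OF V L] detV detL by simp
  ultimately show ?case using V L by (intro bexI[of _ "V * L"]) auto
qed

section \<open>Complex positive definite matrices and their quadratic forms\<close>

definition pos_def_mat :: "nat \<Rightarrow> complex mat \<Rightarrow> bool" where
  "pos_def_mat n H \<longleftrightarrow> (\<forall>z\<in>carrier_vec n. z \<noteq> 0\<^sub>v n \<longrightarrow> 0 < Re ((H *\<^sub>v z) \<bullet>c z))"

lemma mat_adjoint_eq: "mat_adjoint A = transpose_mat (map_mat cnj A)"
  by (intro eq_matI) (auto simp: mat_adjoint_def mat_of_rows_def)

lemma mat_adjoint_carrier: "(A :: complex mat) \<in> carrier_mat m n \<Longrightarrow> mat_adjoint A \<in> carrier_mat n m"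
  unfolding mat_adjoint_eq by simp

lemma mat_adjoint_cscalar_prod:
  fixes A :: "complex mat"
  assumes A: "A \<in> carrier_mat n n" and w: "w \<in> carrier_vec n" and z: "z \<in> carrier_vec n"
  shows "(mat_adjoint A *\<^sub>v w) \<bullet>c z = w \<bullet>c (A *\<^sub>v z)"
proof -
  have "conjugate (A *\<^sub>v z) = map_mat cnj A *\<^sub>v conjugate z"
    using A z by (intro eq_vecI) (auto simp: scalar_prod_def)
  then show ?thesis
    unfolding mat_adjoint_eq using assms
    by (simp add: transpose_vec_mult_scalar[of _ n n])
qed

lemma pos_def_mat_one: "pos_def_mat n (1\<^sub>m n)"
  unfolding pos_def_mat_def
proof (intro ballI impI)
  fix z :: "complex vec" assume z: "z \<in> carrier_vec n" "z \<noteq> 0\<^sub>v n"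
  then have "z \<bullet>c z > 0" by (subst conjugate_square_greater_0_vec[of _ n]) auto
  then show "0 < Re ((1\<^sub>m n *\<^sub>v z) \<bullet>c z)" using z by (simp add: less_complex_def)
qed

text \<open>The form at \<open>z\<close> is the form of \<open>H\<close> at \<open>P z\<close>, and
  \<open>P z\<close> is nonzero because \<open>P\<close> is invertible.\<close>

lemma pos_def_mat_congruence:
  assumes H: "pos_def_mat n H" "H \<in> carrier_mat n n" and P: "P \<in> carrier_mat n n" "det P \<noteq> 0"
  shows "pos_def_mat n (mat_adjoint P * H * P)"
  unfolding pos_def_mat_def
proof (intro ballI impI)
  fix z :: "complex vec" assume z: "z \<in> carrier_vec n" "z \<noteq> 0\<^sub>v n"
  have Pz: "P *\<^sub>v z \<noteq> 0\<^sub>v n"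
    using P z det_0_iff_vec_prod_zero[OF P(1)] by auto
  have "mat_adjoint P * H * P *\<^sub>v z = mat_adjoint P *\<^sub>v (H *\<^sub>v (P *\<^sub>v z))"
    using H P z mat_adjoint_carrier[OF P(1)] by (simp add: assoc_mult_mat_vec[of _ n n _ n])
  then have "(mat_adjoint P * H * P *\<^sub>v z) \<bullet>c z = (H *\<^sub>v (P *\<^sub>v z)) \<bullet>c (P *\<^sub>v z)"
    using H P z by (simp add: mat_adjoint_cscalar_prod[of _ n])
  then show "0 < Re ((mat_adjoint P * H * P *\<^sub>v z) \<bullet>c z)"
    using H P z Pz unfolding pos_def_mat_def by simp
qed

lemma mat_adjoint_cmat: "mat_adjoint (cmat P) = transpose_mat (cmat P)"
  unfolding mat_adjoint_eq by (intro eq_matI) auto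

text \<open>Turns complex positivity into real inequalities. It is evaluated at real vectors to get
  positivity of \<open>S\<close>, and at a vector with real part \<open>K v\<close> and imaginary
  part \<open>v\<close> to get the contraction bound.\<close>

lemma Re_cplx_mat_form:
  assumes S: "S \<in> carrier_mat n n" and A: "A \<in> carrier_mat n n"
    and x: "x \<in> carrier_vec n" and y: "y \<in> carrier_vec n"
  defines "z \<equiv> vec n (\<lambda>i. Complex (x $ i) (y $ i))"
  shows "Re ((cplx_mat S A *\<^sub>v z) \<bullet>c z)
    = (S *\<^sub>v x - A *\<^sub>v y) \<bullet> x + (S *\<^sub>v y + A *\<^sub>v x) \<bullet> y"
proof -
  define w p q where "w = cplx_mat S A *\<^sub>v z" and "p = S *\<^sub>v x - A *\<^sub>v y"
    and "q = S *\<^sub>v y + A *\<^sub>v x"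
  have "Re (w $ i) = p $ i" "Im (w $ i) = q $ i" if "i < n" for i
    using that S A x y unfolding w_def p_def q_def
    by (simp_all add: z_def scalar_prod_def algebra_simps sum.distrib sum_subtractf sum_negf)
  moreover have "p \<in> carrier_vec n" "q \<in> carrier_vec n"
    using S A x y unfolding p_def q_def by auto
  ultimately have "Re (w \<bullet>c z) = p \<bullet> x + q \<bullet> y"
    using x y by (simp add: scalar_prod_def z_def sum.distrib)
  then show ?thesis unfolding w_def p_def q_def .
qed

section \<open>Existence of the decomposition\<close>

text \<open>Multiplying all parameters by a common factor acts as a real power of the block matrix.
  Exponents add, which yields squares, fourth powers and inverses at once.\<close>

lemma B_mat_map_mult:
  assumes "length ts = n div 2"
  shows "B_mat n (map (\<lambda>t. a * t) ts) * B_mat n (map (\<lambda>t. b * t) ts) = B_mat n (map (\<lambda>t. (a + b) * t) ts)"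
proof -
  have even: "B_mat 0 (map (\<lambda>t. a * t) ts) * B_mat 0 (map (\<lambda>t. b * t) ts) = B_mat 0 (map (\<lambda>t. (a + b) * t) ts)"
    for ts
  proof (induction ts)
    case (Cons t ts)
    have "B_mat 0 (map f ts) \<in> carrier_mat (2 * length ts) (2 * length ts)" for f
      using B_mat_0_carrier[of "map f ts"] by simp
    then show ?case
      using Cons by (simp add: B_mat_even_Cons dsum_mult[OF B_block_carrier _ B_block_carrier, of _ "2 * length ts"]
          B_block_mult distrib_right del: index_mat_four_block)
  qed (simp add: B_mat_even_Nil)
  show ?thesis
  proof (cases "even n")
    case True
    then show ?thesis using even[of ts] B_mat_even[of n] by metis
  next
    case False
    have "B_mat 0 (map f ts) \<in> carrier_mat (2 * length ts) (2 * length ts)" for f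
      using B_mat_0_carrier[of "map f ts"] by simp
    then show ?thesis
      unfolding B_mat_odd[OF False] by (subst dsum_mult[of _ 1 _ "2 * length ts"]) (simp_all add: even)
  qed
qed

lemma B_mat_zero:
  assumes "length ts = n div 2"
  shows "B_mat n (map (\<lambda>t. 0 * t) ts) = 1\<^sub>m n"
proof -
  have even: "B_mat 0 (map (\<lambda>t. 0 * t) ts) = 1\<^sub>m (2 * length ts)" for ts
  proof (induction ts)
    case (Cons t ts)
    then show ?case using dsum_one[of 2 "2 * length ts", where 'a = complex]
      by (simp add: B_mat_even_Cons B_block_0)
  qed (simp add: B_mat_even_Nil)
  show ?thesis
  proof (cases "even n")
    case True
    then show ?thesis using even[of ts] B_mat_even[of n] assms by simp
  next
    case False
    then have "n = 1 + 2 * length ts" using assms by presburger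
    then show ?thesis
      unfolding B_mat_odd[OF False] even using dsum_one[of 1 "2 * length ts", where 'a = complex] by simp
  qed
qed

lemma B_block_cnj: "map_mat cnj (B_block t) = B_block (- t)"
  by (rule eq_mat2I) (simp_all add: B_block_carrier B_block_carrier[THEN carrier_matD(1)]
      B_block_carrier[THEN carrier_matD(2)] B_block_index)

lemma B_block_transpose: "transpose_mat (B_block t) = B_block (- t)"
  by (rule eq_mat2I) (simp_all add: B_block_carrier B_block_carrier[THEN carrier_matD(1)]
      B_block_carrier[THEN carrier_matD(2)] B_block_index)

lemma B_mat_cnj: "map_mat cnj (B_mat n ts) = B_mat n (map uminus ts)"
proof -
  have even: "map_mat cnj (B_mat 0 ts) = B_mat 0 (map uminus ts)" for ts
  proof (induction ts)
    case (Cons t ts)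
    then show ?case by (simp add: B_mat_even_Cons dsum_map B_block_cnj)
  qed (simp add: B_mat_even_Nil, auto intro!: eq_matI)
  show ?thesis
  proof (cases "even n")
    case True
    then show ?thesis using even[of ts] B_mat_even[of n] by metis
  next
    case False
    have "map_mat cnj (1\<^sub>m 1) = 1\<^sub>m 1" by (intro eq_matI) auto
    then show ?thesis unfolding B_mat_odd[OF False] by (subst dsum_map) (simp_all add: even)
  qed
qed

lemma B_mat_transpose: "transpose_mat (B_mat n ts) = B_mat n (map uminus ts)"
proof -
  have even: "transpose_mat (B_mat 0 ts) = B_mat 0 (map uminus ts)" for ts
  proof (induction ts)
    case (Cons t ts)
    then show ?case
      by (simp add: B_mat_even_Cons dsum_transpose[OF B_block_carrier B_mat_0_carrier] B_block_transpose)
  qed (simp add: B_mat_even_Nil)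
  show ?thesis
  proof (cases "even n")
    case True
    then show ?thesis using even[of ts] B_mat_even[of n] by metis
  next
    case False
    show ?thesis unfolding B_mat_odd[OF False]
      by (subst dsum_transpose[OF _ B_mat_0_carrier, of _ 1]) (simp_all add: even)
  qed
qed

text \<open>Conjugation and transposition each negate the parameters, so their composition restores
  them.\<close>

lemma B_mat_adjoint: "mat_adjoint (B_mat n ts) = B_mat n ts"
  unfolding mat_adjoint_eq B_mat_cnj B_mat_transpose by (simp add: comp_def)

lemma B_mat_inverse:
  assumes "length ts = n div 2"
  shows "B_mat n ts * B_mat n (map uminus ts) = 1\<^sub>m n" "B_mat n (map uminus ts) * B_mat n ts = 1\<^sub>m n"
  using B_mat_map_mult[OF assms, of 1 "-1"] B_mat_map_mult[OF assms, of "-1" 1] B_mat_zero[OF assms]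
  by simp_all

lemma mat_adjoint_mult:
  fixes A B :: "complex mat"
  assumes "A \<in> carrier_mat n n" "B \<in> carrier_mat n n"
  shows "mat_adjoint (A * B) = mat_adjoint B * mat_adjoint A"
proof -
  have "map_mat cnj (A * B) = map_mat cnj A * map_mat cnj B"
    using assms by (intro eq_matI) (auto simp: scalar_prod_def)
  then show ?thesis
    unfolding mat_adjoint_eq using assms by (simp add: transpose_mult[of _ n n _ n])
qed

lemma mat_adjoint_adjoint: "mat_adjoint (mat_adjoint A) = (A :: complex mat)"
  unfolding mat_adjoint_eq by (intro eq_matI) auto

text \<open>At the vector with real part \<open>K v\<close> and imaginary part \<open>v\<close> the
  form of \<open>1 + \<i> K\<close> is the squared length of \<open>v\<close> minus that of
  \<open>K v\<close>.\<close>

lemma pos_def_cplx_contraction: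
  assumes K: "skew_mat n K" and pos: "pos_def_mat n (cplx_mat (1\<^sub>m n) K)"
  shows "strict_contraction n K"
  unfolding strict_contraction_def
proof (intro ballI impI)
  fix v :: "real vec" assume v: "v \<in> carrier_vec n" "v \<noteq> 0\<^sub>v n"
  have Kc: "K \<in> carrier_mat n n" using K skew_mat_def by auto
  let ?w = "K *\<^sub>v v"
  define z where "z = vec n (\<lambda>i. Complex (?w $ i) (v $ i))"
  have "z \<noteq> 0\<^sub>v n"
  proof
    assume z: "z = 0\<^sub>v n"
    have "v $ i = 0" if "i < n" for i
      using arg_cong[OF z, of "\<lambda>z. Im (z $ i)"] that unfolding z_def by simp
    then show False using v by auto
  qed
  moreover have "z \<in> carrier_vec n" unfolding z_def by simp
  ultimately have "0 < Re ((cplx_mat (1\<^sub>m n) K *\<^sub>v z) \<bullet>c z)" using pos unfolding pos_def_mat_def by auto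
  also have "\<dots> = (1\<^sub>m n *\<^sub>v ?w - ?w) \<bullet> ?w + (1\<^sub>m n *\<^sub>v v + K *\<^sub>v ?w) \<bullet> v"
    unfolding z_def using Kc v by (intro Re_cplx_mat_form) auto
  also have "\<dots> = v \<bullet> v + (K *\<^sub>v ?w) \<bullet> v"
  proof -
    have w0: "1\<^sub>m n *\<^sub>v ?w - ?w = 0\<^sub>v n" using Kc v by (intro eq_vecI) auto
    show ?thesis unfolding w0 using Kc v by (simp add: add_scalar_prod_distrib[of _ n])
  qed
  also have "\<dots> = v \<bullet> v - ?w \<bullet> ?w"
    using skew_scalar_prod[OF K _ v(1), of ?w] Kc v by simp
  finally show "?w \<bullet> ?w < v \<bullet> v" by simp
qed

text \<open>Two congruences are chained: the Cholesky factor of the real part normalizes that part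
  to 1, and the normal form of the resulting skew contraction does the rest.\<close>

lemma hermitian_pos_def_congruent_B_mat:
  assumes H: "H \<in> carrier_mat n n" "mat_adjoint H = H" and pos: "pos_def_mat n H"
  obtains ts where "length ts = n div 2" "real_congruent n H (B_mat n ts * B_mat n ts)"
proof -
  define S A where "S = map_mat Re H" and "A = map_mat Im H"
  have S: "S \<in> carrier_mat n n" and A: "A \<in> carrier_mat n n" using H unfolding S_def A_def by auto
  have HSA: "H = cplx_mat S A"
    unfolding S_def A_def using H by (intro eq_matI) (auto simp: complex_eq)
  have Hij: "cnj (H $$ (j, i)) = H $$ (i, j)" if "i < n" "j < n" for i j
    using arg_cong[OF H(2), of "\<lambda>M. M $$ (i, j)"] that H(1) unfolding mat_adjoint_eq by simp
  have St: "transpose_mat S = S"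
    using S H(1) Hij by (intro eq_matI) (auto simp: S_def complex_eq_iff)
  have At: "transpose_mat A = - A"
  proof (rule eq_matI)
    fix i j assume "i < dim_row (- A)" "j < dim_col (- A)"
    then show "transpose_mat A $$ (i, j) = (- A) $$ (i, j)"
      using A H(1) arg_cong[OF Hij, of i j Im] by (simp add: A_def)
  qed (use A in auto)
  have "\<exists>W\<in>carrier_mat n n. det W \<noteq> 0 \<and> S = transpose_mat W * W"
  proof (rule cholesky[OF S St])
    fix x :: "real vec" assume x: "x \<in> carrier_vec n" "x \<noteq> 0\<^sub>v n"
    \<comment> \<open>On a vector with zero imaginary part only \<open>S\<close> contributes to the
      real part of the form.\<close>
    define z where "z = vec n (\<lambda>i. Complex (x $ i) (0\<^sub>v n $ i))"
    have "z \<noteq> 0\<^sub>v n"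
    proof
      assume z: "z = 0\<^sub>v n"
      have "x $ i = 0" if "i < n" for i
        using arg_cong[OF z, of "\<lambda>z. Re (z $ i)"] that unfolding z_def by simp
      then show False using x by auto
    qed
    moreover have "z \<in> carrier_vec n" unfolding z_def by simp
    ultimately have "0 < Re ((H *\<^sub>v z) \<bullet>c z)" using pos unfolding pos_def_mat_def by auto
    also have "\<dots> = (S *\<^sub>v x - A *\<^sub>v 0\<^sub>v n) \<bullet> x + (S *\<^sub>v 0\<^sub>v n + A *\<^sub>v x) \<bullet> 0\<^sub>v n"
      unfolding HSA z_def using S A x by (intro Re_cplx_mat_form) auto
    also have "\<dots> = (S *\<^sub>v x) \<bullet> x"
    proof -
      have "A *\<^sub>v 0\<^sub>v n = 0\<^sub>v n" using A by (intro eq_vecI) auto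
      moreover have "S *\<^sub>v 0\<^sub>v n + A *\<^sub>v x \<in> carrier_vec n" using S A x by auto
      ultimately show ?thesis using S x by simp
    qed
    also have "\<dots> = x \<bullet> (S *\<^sub>v x)" using S x by (intro comm_scalar_prod[of _ n]) auto
    finally show "0 < x \<bullet> (S *\<^sub>v x)" .
  qed
  then obtain W where W: "W \<in> carrier_mat n n" "det W \<noteq> 0" "S = transpose_mat W * W" by auto
  \<comment> \<open>The inverse of the Cholesky factor carries \<open>S\<close> to the identity and
    \<open>A\<close> to another skew-symmetric matrix \<open>K\<close>.\<close>
  obtain P where P: "P \<in> carrier_mat n n" "W * P = 1\<^sub>m n" "P * W = 1\<^sub>m n"
    using W(1,2) by (rule inverse_mat_obtain)
  have detP: "det P \<noteq> 0" by (rule det_nonzero_of_right_inverse[OF P(1) W(1) P(3)])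
  define K where "K = transpose_mat P * A * P"
  have K: "skew_mat n K"
    unfolding K_def using A At P(1) by (intro skew_mat_congruence) (auto simp: skew_mat_def)
  have "transpose_mat P * S * P = transpose_mat (W * P) * (W * P)"
    unfolding W(3) using W P(1) by (simp add: transpose_mult[of _ n n _ n] assoc_mult_mat[of _ n n _ n _ n])
  also have "\<dots> = 1\<^sub>m n" using P by simp
  finally have PSP: "transpose_mat P * S * P = 1\<^sub>m n" .
  have HK: "transpose_mat (cmat P) * H * cmat P = cplx_mat (1\<^sub>m n) K"
    unfolding HSA cplx_mat_congruence[OF S A P(1)] PSP K_def ..
  have "pos_def_mat n (cplx_mat (1\<^sub>m n) K)"
    unfolding HK[symmetric] mat_adjoint_cmat[symmetric]
    using pos H P detP by (intro pos_def_mat_congruence) auto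
  then obtain ts where ts: "length ts = n div 2"
    and rc: "real_congruent n (cplx_mat (1\<^sub>m n) K) (B_mat n ts * B_mat n ts)"
    using skew_contraction_congruent_B_mat[OF K pos_def_cplx_contraction[OF K]] by auto
  have "real_congruent n H (cplx_mat (1\<^sub>m n) K)"
    unfolding HK[symmetric] by (rule real_congruent_of_transform[OF H(1) P(1) detP])
  from real_congruent_trans[OF _ this rc] B_mat_carrier[OF ts]
  have "real_congruent n H (B_mat n ts * B_mat n ts)" by auto
  with ts show thesis by (rule that)
qed

lemma cmat_inverse:
  assumes "V \<in> carrier_mat n n" "det V \<noteq> 0"
  obtains W where "W \<in> carrier_mat n n" "cmat V * W = 1\<^sub>m n" "W * cmat V = 1\<^sub>m n"
  using inverse_mat_obtain[of "cmat V" n] assms by auto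

lemma UBV_decomposition_exists:
  assumes G: "G \<in> carrier_mat n n" "det G \<noteq> 0"
  obtains U ts V where "is_UBV_decomposition n G U ts V"
proof -
  have aG: "mat_adjoint G \<in> carrier_mat n n" by (rule mat_adjoint_carrier[OF G(1)])
  define H where "H = mat_adjoint G * G"
  have H: "H \<in> carrier_mat n n" using aG G unfolding H_def by auto
  have "mat_adjoint H = H"
    unfolding H_def mat_adjoint_mult[OF aG G(1)] mat_adjoint_adjoint ..
  \<comment> \<open>\<open>H\<close> is the congruence of the identity by \<open>G\<close>
    itself.\<close>
  moreover have "pos_def_mat n H"
    using pos_def_mat_congruence[OF pos_def_mat_one _ G] aG unfolding H_def by simp
  ultimately obtain ts where ts: "length ts = n div 2" and "real_congruent n H (B_mat n ts * B_mat n ts)"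
    using hermitian_pos_def_congruent_B_mat[OF H] by metis
  then obtain V where V: "V \<in> carrier_mat n n" "det V \<noteq> 0"
      "H = transpose_mat (cmat V) * (B_mat n ts * B_mat n ts) * cmat V"
    unfolding real_congruent_def by auto
  obtain W where W: "W \<in> carrier_mat n n" "cmat V * W = 1\<^sub>m n" "W * cmat V = 1\<^sub>m n"
    using V(1,2) by (rule cmat_inverse)
  define B C where "B = B_mat n ts" and "C = B_mat n (map uminus ts)"
  have B: "B \<in> carrier_mat n n" and C: "C \<in> carrier_mat n n"
    unfolding B_def C_def using ts by (auto intro!: B_mat_carrier)
  have BC: "B * C = 1\<^sub>m n" "C * B = 1\<^sub>m n" unfolding B_def C_def using B_mat_inverse[OF ts] by auto
  \<comment> \<open>Forced by \<open>G = U B V\<close>, as \<open>W\<close> inverts \<open>V\<close>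
    and \<open>C\<close> inverts \<open>B\<close>. In the adjoint of \<open>U\<close> times
    \<open>U\<close> the factors of \<open>V\<close> cancel against those of \<open>W\<close>, and
    \<open>C * B * B * C\<close> remains.\<close>
  define U where "U = G * (W * C)"
  have U: "U \<in> carrier_mat n n" using G W C unfolding U_def by auto
  have aW: "mat_adjoint W * transpose_mat (cmat V) = 1\<^sub>m n"
  proof -
    have "mat_adjoint (cmat V * W) = 1\<^sub>m n" unfolding W(2) by (simp add: mat_adjoint_eq, intro eq_matI) auto
    then show ?thesis using mat_adjoint_mult[of "cmat V" n W] V W by (simp add: mat_adjoint_cmat)
  qed
  have aWc: "mat_adjoint W \<in> carrier_mat n n" by (rule mat_adjoint_carrier[OF W(1)])
  have "mat_adjoint U * U = mat_adjoint (W * C) * H * (W * C)"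
    unfolding U_def H_def using G W C aG mat_adjoint_carrier[of "W * C" n n]
    by (subst mat_adjoint_mult[of _ n]) (auto simp: assoc_mult_mat[of _ n n _ n _ n])
  also have "mat_adjoint (W * C) = C * mat_adjoint W"
    unfolding mat_adjoint_mult[OF W(1) C] unfolding C_def B_mat_adjoint ..
  also have "C * mat_adjoint W * H * (W * C)
      = C * ((mat_adjoint W * transpose_mat (cmat V)) * (B * (B * ((cmat V * W) * C))))"
    unfolding V(3) B_def[symmetric] using V(1) W(1) C B aWc by (simp add: assoc_mult_mat[of _ n n _ n _ n])
  also have "\<dots> = 1\<^sub>m n" unfolding aW W(2) using B C BC by simp
  finally have UU: "mat_adjoint U * U = 1\<^sub>m n" .
  then have "U * mat_adjoint U = 1\<^sub>m n"
    using mat_mult_left_right_inverse[OF mat_adjoint_carrier[OF U] U] by auto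
  moreover have "U * B * cmat V = G"
  proof -
    have "U * B * cmat V = G * (W * ((C * B) * cmat V))"
      unfolding U_def using G W C B V by (simp add: assoc_mult_mat[of _ n n _ n _ n])
    then show ?thesis using BC W V G by simp
  qed
  ultimately have "is_UBV_decomposition n G U ts V"
    unfolding is_UBV_decomposition_def unitary_mat_def B_def[symmetric]
    using U UU ts V invertible_mat_iff_det[OF V(1)] by auto
  then show thesis by (rule that)
qed

section \<open>Uniqueness of the parameters\<close>

text \<open>With \<open>H = G\<^sup>* G = V\<^sup>T B\<^sup>2 V\<close> and \<open>cnj B = B\<^sup>-\<^sup>1\<close>, the matrix \<open>(cnj H)\<^sup>-\<^sup>1 H\<close>, which depends on \<open>G\<close> only,
  equals \<open>V\<^sup>-\<^sup>1 B\<^sup>4 V\<close>.\<close>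
lemma UBV_decomposition_similar:
  assumes G: "G \<in> carrier_mat n n" and dec: "is_UBV_decomposition n G U ts V"
    and N: "N \<in> carrier_mat n n" "N * map_mat cnj (mat_adjoint G * G) = 1\<^sub>m n"
  shows "similar_mat (N * (mat_adjoint G * G)) (B_mat n (map (\<lambda>t. 4 * t) ts))"
proof -
  from dec have U: "U \<in> carrier_mat n n" "mat_adjoint U * U = 1\<^sub>m n" and ts: "length ts = n div 2"
    and V: "V \<in> carrier_mat n n" "det V \<noteq> 0" and GUV: "G = U * B_mat n ts * cmat V"
    unfolding is_UBV_decomposition_def unitary_mat_def by (auto simp: invertible_mat_iff_det)
  obtain W where W: "W \<in> carrier_mat n n" "cmat V * W = 1\<^sub>m n" "W * cmat V = 1\<^sub>m n"
    using V by (rule cmat_inverse)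
  have Bc: "B_mat n (map (\<lambda>t. a * t) ts) \<in> carrier_mat n n" for a
    using ts by (intro B_mat_carrier) simp
  have B1: "B_mat n ts \<in> carrier_mat n n" using ts by (rule B_mat_carrier)
  have aU: "mat_adjoint U \<in> carrier_mat n n" by (rule mat_adjoint_carrier[OF U(1)])
  define Vt where "Vt = transpose_mat (cmat V)"
  have Vt: "Vt \<in> carrier_mat n n" unfolding Vt_def using V by simp
  have "mat_adjoint G = Vt * (B_mat n ts * mat_adjoint U)"
    unfolding GUV Vt_def using U(1) aU V B1
    by (simp add: mat_adjoint_mult[of _ n] B_mat_adjoint mat_adjoint_cmat assoc_mult_mat[of _ n n _ n _ n])
  \<comment> \<open>The products are grouped so that the unitary factor cancels.\<close>
  then have "mat_adjoint G * G = Vt * (B_mat n ts * ((mat_adjoint U * U) * (B_mat n ts * cmat V)))"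
    unfolding GUV using U(1) aU V B1 Vt by (simp add: assoc_mult_mat[of _ n n _ n _ n])
  also have "\<dots> = Vt * (B_mat n ts * B_mat n ts) * cmat V"
    unfolding U(2) using V B1 Vt by (simp add: assoc_mult_mat[of _ n n _ n _ n])
  also have "B_mat n ts * B_mat n ts = B_mat n (map (\<lambda>t. 2 * t) ts)"
    using B_mat_map_mult[OF ts, of 1 1] by simp
  finally have H: "mat_adjoint G * G = Vt * B_mat n (map (\<lambda>t. 2 * t) ts) * cmat V" .
  have cnj_mult: "map_mat cnj (X * Y) = map_mat cnj X * map_mat cnj Y"
    if "X \<in> carrier_mat n n" "Y \<in> carrier_mat n n" for X Y
    using that by (intro eq_matI) (auto simp: scalar_prod_def)
  \<comment> \<open>Conjugation leaves the real factors alone and inverts the middle one.\<close>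
  have "map_mat cnj (mat_adjoint G * G) = Vt * B_mat n (map (\<lambda>t. - 2 * t) ts) * cmat V"
  proof -
    have "map_mat cnj Vt = Vt" "map_mat cnj (cmat V) = cmat V"
      unfolding Vt_def by (auto intro!: eq_matI)
    then show ?thesis
      unfolding H using Vt V Bc by (simp add: cnj_mult B_mat_cnj comp_def)
  qed
  with N have NH: "N * (Vt * B_mat n (map (\<lambda>t. - 2 * t) ts) * cmat V) = 1\<^sub>m n" by simp
  \<comment> \<open>Writing the exponent 2 as -2 + 4 and inserting \<open>V W = 1\<close> exposes
    the conjugate of the adjoint of \<open>G\<close> times \<open>G\<close> as a left factor, which
    \<open>N\<close> then cancels.\<close>
  have "mat_adjoint G * G
      = Vt * (B_mat n (map (\<lambda>t. - 2 * t) ts) * B_mat n (map (\<lambda>t. 4 * t) ts)) * cmat V"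
    unfolding H B_mat_map_mult[OF ts] by simp
  also have "\<dots> = Vt * B_mat n (map (\<lambda>t. - 2 * t) ts) * ((cmat V * W) * (B_mat n (map (\<lambda>t. 4 * t) ts) * cmat V))"
    unfolding W(2) using Vt V Bc[of "-2"] Bc[of 4] by (simp add: assoc_mult_mat[of _ n n _ n _ n])
  also have "\<dots> = (Vt * B_mat n (map (\<lambda>t. - 2 * t) ts) * cmat V) * (W * B_mat n (map (\<lambda>t. 4 * t) ts) * cmat V)"
    using Vt V W(1) Bc[of "-2"] Bc[of 4] by (simp add: assoc_mult_mat[of _ n n _ n _ n])
  finally have "N * (mat_adjoint G * G)
      = (N * (Vt * B_mat n (map (\<lambda>t. - 2 * t) ts) * cmat V)) * (W * B_mat n (map (\<lambda>t. 4 * t) ts) * cmat V)"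
    using N(1) Vt V W(1) Bc[of "-2"] Bc[of 4] by (simp add: assoc_mult_mat[of _ n n _ n _ n])
  also have "\<dots> = W * B_mat n (map (\<lambda>t. 4 * t) ts) * cmat V"
    unfolding NH using V W(1) Bc[of 4] by simp
  finally show ?thesis
    using W V Bc[of 4] by (intro similar_matI[of _ _ W "cmat V" n]) auto
qed

section \<open>Characteristic polynomials and recovery of the parameters\<close>

lemma char_poly_dsum:
  fixes A B :: "'a :: idom mat"
  assumes A: "A \<in> carrier_mat k k" and B: "B \<in> carrier_mat m m"
  shows "char_poly (dsum A B) = char_poly A * char_poly B"
proof -
  have "char_poly_matrix (dsum A B) = dsum (char_poly_matrix A) (char_poly_matrix B)"
    using A B by (intro eq_matI) (auto simp: char_poly_matrix_def)
  then show ?thesis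
    unfolding char_poly_def using A B by (simp only:) (intro dsum_det char_poly_matrix_closed)
qed

lemma det_mat2:
  fixes A :: "'a :: idom mat"
  assumes A: "A \<in> carrier_mat 2 2"
  shows "det A = A $$ (0, 0) * A $$ (1, 1) - A $$ (0, 1) * A $$ (1, 0)"
proof -
  have "mat_delete A 0 0 \<in> carrier_mat 1 1" "mat_delete A 0 1 \<in> carrier_mat 1 1"
    using A by (auto simp: mat_delete_def)
  then show ?thesis
    unfolding laplace_expansion_row[OF A zero_less_numeral]
    using A by (simp add: numeral_2_eq_2 cofactor_def det_single mat_delete_def)
qed

text \<open>The trace is \<open>2 * cosh t\<close>, and the determinant is 1 by the hyperbolic
  Pythagorean identity.\<close>

lemma char_poly_B_block: "char_poly (B_block t) = [:1, - 2 * complex_of_real (cosh t), 1:]"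
proof -
  have "complex_of_real ((cosh t)\<^sup>2 - (sinh t)\<^sup>2) = 1"
    unfolding hyperbolic_pythagoras by simp
  then have "complex_of_real (cosh t) * complex_of_real (cosh t) - complex_of_real (sinh t) * complex_of_real (sinh t) = 1"
    by (simp add: power2_eq_square)
  then show ?thesis
    unfolding char_poly_def using B_block_carrier[of t]
    by (subst det_mat2) (auto simp: char_poly_matrix_def B_block_index algebra_simps)
qed

text \<open>The factor of the leading 1 stays unevaluated: it depends on the parity of
  \<open>n\<close> alone and cancels when two decompositions are compared.\<close>

lemma char_poly_B_mat:
  "char_poly (B_mat n ts) = (if even n then 1 else char_poly (1\<^sub>m 1))
    * (\<Prod>t\<leftarrow>ts. [:1, - 2 * complex_of_real (cosh t), 1:])"
proof -
  have even: "char_poly (B_mat 0 ts) = (\<Prod>t\<leftarrow>ts. [:1, - 2 * complex_of_real (cosh t), 1:])"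
  proof (induction ts)
    case Nil
    then show ?case by (simp add: B_mat_even_Nil char_poly_def)
  next
    case (Cons t ts)
    then show ?case
      by (simp only: B_mat_even_Cons[OF dvd_0_right] char_poly_dsum[OF B_block_carrier B_mat_0_carrier]
          char_poly_B_block list.map prod_list.Cons)
  qed
  show ?thesis
  proof (cases "even n")
    case True
    then show ?thesis using even B_mat_even[of n ts] by simp
  next
    case False
    then show ?thesis
      unfolding B_mat_odd[OF False] char_poly_dsum[OF one_carrier_mat B_mat_0_carrier] even by simp
  qed
qed

text \<open>The factor of \<open>t\<close> vanishes at \<open>exp t\<close>, so some factor on the
  other side does too. That one has a parameter of the same modulus and, cosh being even, is the
  same polynomial; it can be cancelled before the induction goes on.\<close>

lemma mset_abs_eq_of_cosh_prod_eq:
  assumes "length ts = length us"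
    and "(\<Prod>t\<leftarrow>ts. [:1, - 2 * complex_of_real (cosh t), 1:]) = (\<Prod>u\<leftarrow>us. [:1, - 2 * complex_of_real (cosh u), 1:])"
  shows "mset (map abs ts) = mset (map abs us)"
  using assms
proof (induction ts arbitrary: us)
  case (Cons t ts)
  define q where "q t = [:1, - 2 * complex_of_real (cosh t), 1:]" for t
  \<comment> \<open>The two roots of \<open>q u\<close> are \<open>exp u\<close> and
    \<open>exp (- u)\<close>.\<close>
  have root: "poly (q u) (complex_of_real (exp s)) = 0 \<longleftrightarrow> \<bar>u\<bar> = \<bar>s\<bar>" for u s
  proof -
    have factor: "1 + x * (x - 2 * ((a + b) / 2)) = (x - a) * (x - b)" if "a * b = 1" for a b x :: real
      using that by (simp add: algebra_simps)
    have "poly (q u) (complex_of_real (exp s)) = complex_of_real (1 + exp s * (exp s - 2 * cosh u))"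
      unfolding q_def by simp
    also have "1 + exp s * (exp s - 2 * cosh u) = (exp s - exp u) * (exp s - exp (- u))"
      unfolding cosh_field_def by (rule factor) (simp flip: exp_add)
    also have "complex_of_real \<dots> = 0 \<longleftrightarrow> \<bar>u\<bar> = \<bar>s\<bar>" by (auto simp: abs_if)
    finally show ?thesis .
  qed
  have prods: "q t * (\<Prod>t\<leftarrow>ts. q t) = (\<Prod>u\<leftarrow>us. q u)"
    using Cons.prems(2) unfolding q_def by simp
  have "poly (\<Prod>u\<leftarrow>us. q u) (complex_of_real (exp t)) = 0"
    unfolding prods[symmetric] poly_mult using root[of t t] by simp
  then have "\<exists>u\<in>set us. poly (q u) (complex_of_real (exp t)) = 0"
    by (induction us) auto
  then obtain u where u: "u \<in> set us" "\<bar>u\<bar> = \<bar>t\<bar>" using root by auto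
  then obtain as bs where us: "us = as @ u # bs" by (meson split_list)
  have "cosh u = cosh t" using u(2) by (metis cosh_real_abs)
  then have "q u = q t" unfolding q_def by simp
  then have "q t * (\<Prod>t\<leftarrow>ts. q t) = q t * (\<Prod>u\<leftarrow>as @ bs. q u)"
    using prods unfolding us by (simp add: ac_simps)
  moreover have "q t \<noteq> 0" unfolding q_def by simp
  ultimately have "(\<Prod>t\<leftarrow>ts. q t) = (\<Prod>u\<leftarrow>as @ bs. q u)" by simp
  then have "mset (map abs ts) = mset (map abs (as @ bs))"
    using Cons.prems(1) us unfolding q_def by (intro Cons.IH) simp_all
  then show ?case using u(2) unfolding us by simp
qed simp

text \<open>Equal multisets of moduli are matched by a permutation of positions; matched entries
  have equal modulus and so differ by a sign.\<close>

lemma eq_up_to_order_and_signs_of_mset_abs: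
  assumes "mset (map abs ts) = mset (map abs us)"
  shows "eq_up_to_order_and_signs ts us"
proof -
  have len: "length ts = length us" using assms by (metis length_map size_mset)
  from mset_eq_permutation[OF assms[symmetric]]
  obtain p where "p permutes {..<length (map abs ts)}" and p2: "permute_list p (map abs ts) = map abs us"
    by blast
  then have p: "p permutes {..<length ts}" by simp
  have abs: "\<bar>us ! l\<bar> = \<bar>ts ! p l\<bar>" if "l < length ts" for l
  proof -
    have "permute_list p (map abs ts) ! l = map abs ts ! p l"
      using p that by (intro permute_list_nth) auto
    moreover have "p l < length ts" using permutes_in_image[OF p, of l] that by simp
    ultimately show ?thesis using p2 that len by simp
  qed
  show ?thesis
    unfolding eq_up_to_order_and_signs_def
  \<comment> \<open>The sign defaults to 1 for equal entries, in particular for zeros.\<close>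
  proof (intro conjI exI[of _ p] exI[of _ "\<lambda>l. if us ! l = ts ! p l then 1 else - 1"] allI impI)
    fix l assume "l < length ts"
    then show "us ! l = (if us ! l = ts ! p l then 1 else - 1) * ts ! p l"
      using abs[of l] by (auto simp: abs_if split: if_splits)
  qed (use len p in auto)
qed

lemma UBV_decomposition_unique:
  assumes G: "G \<in> carrier_mat n n" "det G \<noteq> 0"
    and dec: "is_UBV_decomposition n G U ts V" "is_UBV_decomposition n G U' us V'"
  shows "eq_up_to_order_and_signs ts us"
proof -
  let ?H = "mat_adjoint G * G"
  have aG: "mat_adjoint G \<in> carrier_mat n n" by (rule mat_adjoint_carrier[OF G(1)])
  have "det ?H \<noteq> 0"
  proof -
    obtain F where F: "F \<in> carrier_mat n n" "G * F = 1\<^sub>m n" using G by (rule inverse_mat_obtain)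
    have "mat_adjoint F * mat_adjoint G = mat_adjoint (1\<^sub>m n)"
      using mat_adjoint_mult[OF G(1) F(1)] F(2) by simp
    also have "\<dots> = 1\<^sub>m n" unfolding mat_adjoint_eq by (intro eq_matI) auto
    finally have "mat_adjoint G * mat_adjoint F = 1\<^sub>m n"
      using mat_mult_left_right_inverse[OF mat_adjoint_carrier[OF F(1)] aG] by simp
    then have "det (mat_adjoint G) \<noteq> 0"
      using det_nonzero_of_right_inverse[OF aG mat_adjoint_carrier[OF F(1)]] by simp
    then show ?thesis using det_mult[OF aG G(1)] G(2) by simp
  qed
  then obtain M where M: "M \<in> carrier_mat n n" "M * ?H = 1\<^sub>m n"
    using inverse_mat_obtain[of ?H n] aG G by auto
  \<comment> \<open>The inverse of the conjugate of \<open>?H\<close>. It is built from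
    \<open>G\<close> alone, so both block matrices are similar to one and the same matrix.\<close>
  define N where "N = map_mat cnj M"
  have N: "N \<in> carrier_mat n n" unfolding N_def using M by simp
  have "N * map_mat cnj ?H = map_mat cnj (M * ?H)"
    unfolding N_def using M(1) aG G(1) by (intro eq_matI) (auto simp: scalar_prod_def)
  also have "\<dots> = 1\<^sub>m n" unfolding M(2) by (intro eq_matI) auto
  finally have NH: "N * map_mat cnj ?H = 1\<^sub>m n" .
  have "char_poly (B_mat n (map (\<lambda>t. 4 * t) ts)) = char_poly (B_mat n (map (\<lambda>t. 4 * t) us))"
    using dec[THEN UBV_decomposition_similar[OF G(1) _ N NH], THEN char_poly_similar] by simp
  moreover have "char_poly (1\<^sub>m 1 :: complex mat) \<noteq> 0"
    using degree_monic_char_poly[of "1\<^sub>m 1 :: complex mat" 1] by auto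
  ultimately have "(\<Prod>t\<leftarrow>map (\<lambda>t. 4 * t) ts. [:1, - 2 * complex_of_real (cosh t), 1:])
      = (\<Prod>u\<leftarrow>map (\<lambda>t. 4 * t) us. [:1, - 2 * complex_of_real (cosh u), 1:])"
    unfolding char_poly_B_mat by (auto split: if_splits)
  moreover have "length ts = length us" using dec unfolding is_UBV_decomposition_def by simp
  ultimately have "mset (map abs (map (\<lambda>t. 4 * t) ts)) = mset (map abs (map (\<lambda>t. 4 * t) us))"
    by (intro mset_abs_eq_of_cosh_prod_eq) simp_all
  \<comment> \<open>Undoes the factor 4 that came from the fourth power.\<close>
  then have "image_mset (\<lambda>x. x / 4) (mset (map abs (map (\<lambda>t. 4 * t) ts)))
      = image_mset (\<lambda>x. x / 4) (mset (map abs (map (\<lambda>t. 4 * t) us)))"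
    by simp
  then have "mset (map abs ts) = mset (map abs us)"
    by (simp add: multiset.map_comp comp_def abs_mult)
  then show ?thesis by (rule eq_up_to_order_and_signs_of_mset_abs)
qed

theorem theorem5p12:
  fixes n :: nat and G :: "complex mat"
  assumes "G \<in> carrier_mat n n" and "invertible_mat G"
  shows "\<exists>U V \<theta>. is_UBV_decomposition n G U \<theta> V \<and>
           (\<forall>U' V' \<theta>'. is_UBV_decomposition n G U' \<theta>' V' \<longrightarrow> eq_up_to_order_and_signs \<theta> \<theta>')"
proof -
  have "det G \<noteq> 0" using assms invertible_mat_iff_det by auto
  then show ?thesis
    using UBV_decomposition_exists[OF assms(1)] UBV_decomposition_unique[OF assms(1)] by metis
qed

end
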